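(* Let $G=(V,E)$ be a simple graph and let $(P_1,P_2)$ be a partition of $E$ into two pseudoforests. Then this partition can be converted, in linear time, into a partition of $E$ into two forests $F_1,F_2$ and a linear forest $L$, where the edges of $L$ come from $P_1$ and $P_2$ alternatingly (along each path of $L$).
   Context: A pseudoforest is a graph in which each connected component contains at most one cycle. A forest is an acyclic graph; a linear forest is a forest all of whose connected components are paths. *)

theory Defs
  imports Main
begin

section \<open>Graphs\<close>

text \<open>An edge is the two-element set of its end vertices; a subset of the edge set stands for the
  spanning subgraph with these edges.\<close>

definition simple_graph :: "'a set \<Rightarrow> 'a set set \<Rightarrow> bool" where
  "simple_graph V E \<longleftrightarrow> finite V \<and> (\<forall>e\<in>E. \<exists>u\<in>V. \<exists>v\<in>V. u \<noteq> v \<and> e = {u, v})"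

definition path_edges :: "'a list \<Rightarrow> 'a set set" where
  "path_edges xs = {{xs ! i, xs ! Suc i} | i. Suc i < length xs}"

definition cycle_edges :: "'a list \<Rightarrow> 'a set set" where
  "cycle_edges xs = {{xs ! i, xs ! (Suc i mod length xs)} | i. i < length xs}"

text \<open>Cycles are subgraphs: the same cycle traversed from another start vertex or in the other
  direction is not counted again.\<close>

definition cycles :: "'a set set \<Rightarrow> 'a set set set" where
  "cycles F = {cycle_edges xs | xs. distinct xs \<and> 3 \<le> length xs \<and> cycle_edges xs \<subseteq> F}"

definition reachable :: "'a set set \<Rightarrow> 'a \<Rightarrow> 'a \<Rightarrow> bool" where
  "reachable F = (\<lambda>u v. {u, v} \<in> F)\<^sup>*\<^sup>*"

definition components :: "'a set \<Rightarrow> 'a set set \<Rightarrow> 'a set set" where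
  "components V F = {{u. reachable F v u} | v. v \<in> V}"

definition pseudoforest :: "'a set \<Rightarrow> 'a set set \<Rightarrow> bool" where
  "pseudoforest V F \<longleftrightarrow>
     (\<forall>K\<in>components V F. \<forall>C\<in>cycles F. \<forall>D\<in>cycles F. \<Union>C \<subseteq> K \<and> \<Union>D \<subseteq> K \<longrightarrow> C = D)"

definition forest :: "'a set set \<Rightarrow> bool" where
  "forest F \<longleftrightarrow> cycles F = {}"

text \<open>The component with vertex set \<open>K\<close> is the path that visits the vertices \<open>xs\<close> in this order
  (a single vertex counts as a path).\<close>

definition is_path_of :: "'a set set \<Rightarrow> 'a set \<Rightarrow> 'a list \<Rightarrow> bool" where
  "is_path_of F K xs \<longleftrightarrow> distinct xs \<and> set xs = K \<and> {e \<in> F. e \<subseteq> K} = path_edges xs"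

definition linear_forest :: "'a set \<Rightarrow> 'a set set \<Rightarrow> bool" where
  "linear_forest V F \<longleftrightarrow> forest F \<and> (\<forall>K\<in>components V F. \<exists>xs. is_path_of F K xs)"

definition alternating_path :: "'a set set \<Rightarrow> 'a set set \<Rightarrow> 'a list \<Rightarrow> bool" where
  "alternating_path A B xs \<longleftrightarrow>
     path_edges xs \<subseteq> A \<union> B \<and>
     (\<forall>i. Suc (Suc i) < length xs \<longrightarrow>
        {xs ! i, xs ! Suc i} \<in> A \<and> {xs ! Suc i, xs ! Suc (Suc i)} \<in> B \<or>
        {xs ! i, xs ! Suc i} \<in> B \<and> {xs ! Suc i, xs ! Suc (Suc i)} \<in> A)"

definition alternating_forest :: "'a set \<Rightarrow> 'a set set \<Rightarrow> 'a set set \<Rightarrow> 'a set set \<Rightarrow> bool" where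
  "alternating_forest V A B F \<longleftrightarrow>
     (\<forall>K\<in>components V F. \<forall>xs. is_path_of F K xs \<longrightarrow> alternating_path A B xs)"


section \<open>Random access machines\<close>

text \<open>Running time is counted on a random access machine, programmed by while-programs over named
  arrays of natural numbers; cell 0 of an array serves as a scalar variable. Arrays are unbounded
  and, apart from the input, initially zero.

  Every executed command or test costs one unit. This is an honest measure up to a constant factor:
  a program is fixed, so its expressions have bounded size, and the only arithmetic is increment and
  decrement, so that in \<open>t\<close> steps numbers grow by at most \<open>O(t)\<close> (lemma \<open>exec_growth\<close> below). Hence
  a linear-time program uses only numbers of logarithmic bit length.\<close>

type_synonym memory = "string \<Rightarrow> nat \<Rightarrow> nat"

datatype aexp = Const nat | Get string aexp | Inc aexp | Dec aexp

datatype bexp = Eq aexp aexp | Less aexp aexp | Neg bexp | Conj bexp bexp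

datatype com =
    Skip
  | Store string aexp aexp
  | Seq com com
  | Cond bexp com com
  | While bexp com

primrec aval :: "aexp \<Rightarrow> memory \<Rightarrow> nat" where
  "aval (Const k) s = k"
| "aval (Get a e) s = s a (aval e s)"
| "aval (Inc e) s = aval e s + 1"
| "aval (Dec e) s = aval e s - 1"

primrec bval :: "bexp \<Rightarrow> memory \<Rightarrow> bool" where
  "bval (Eq e f) s \<longleftrightarrow> aval e s = aval f s"
| "bval (Less e f) s \<longleftrightarrow> aval e s < aval f s"
| "bval (Neg b) s \<longleftrightarrow> \<not> bval b s"
| "bval (Conj b d) s \<longleftrightarrow> bval b s \<and> bval d s"

text \<open>\<open>exec c s t s'\<close>: started in memory \<open>s\<close>, the program \<open>c\<close> terminates in memory \<open>s'\<close> after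
  exactly \<open>t\<close> steps.\<close>

inductive exec :: "com \<Rightarrow> memory \<Rightarrow> nat \<Rightarrow> memory \<Rightarrow> bool" where
  Skip: "exec Skip s 1 s"
| Store: "exec (Store a i e) s 1 (s(a := (s a)(aval i s := aval e s)))"
| Seq: "exec c s t s' \<Longrightarrow> exec d s' t' s'' \<Longrightarrow> exec (Seq c d) s (t + t') s''"
| CondTrue: "bval b s \<Longrightarrow> exec c s t s' \<Longrightarrow> exec (Cond b c d) s (1 + t) s'"
| CondFalse: "\<not> bval b s \<Longrightarrow> exec d s t s' \<Longrightarrow> exec (Cond b c d) s (1 + t) s'"
| WhileFalse: "\<not> bval b s \<Longrightarrow> exec (While b c) s 1 s"
| WhileTrue: "bval b s \<Longrightarrow> exec c s t s' \<Longrightarrow> exec (While b c) s' t' s'' \<Longrightarrow>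
    exec (While b c) s (1 + t + t') s''"

inductive_cases exec_SkipE: "exec Skip s t s'"
inductive_cases exec_StoreE: "exec (Store a i e) s t s'"
inductive_cases exec_SeqE: "exec (Seq c d) s t s'"
inductive_cases exec_CondE: "exec (Cond b c d) s t s'"
inductive_cases exec_WhileE: "exec (While b c) s t s'"

lemma exec_deterministic:
  "exec c s t s' \<Longrightarrow> exec c s u r \<Longrightarrow> t = u \<and> s' = r"
proof (induction arbitrary: u r rule: exec.induct)
  case (Seq c s t s' d t' s'')
  from Seq.prems obtain v v' q where "exec c s v q" "exec d q v' r" "u = v + v'"
    by (elim exec_SeqE)
  with Seq.IH show ?case by metis
next
  case (CondTrue b s c t s' d)
  from CondTrue.prems CondTrue.hyps obtain v where "exec c s v r" "u = 1 + v"
    by (elim exec_CondE) simp_all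
  with CondTrue.IH show ?case by metis
next
  case (CondFalse b s d t s' c)
  from CondFalse.prems CondFalse.hyps obtain v where "exec d s v r" "u = 1 + v"
    by (elim exec_CondE) simp_all
  with CondFalse.IH show ?case by metis
next
  case (WhileFalse b s c)
  from WhileFalse.prems show ?case
    by (cases rule: exec_WhileE) (use WhileFalse.hyps in auto)
next
  case (WhileTrue b s c t s' t' s'')
  from WhileTrue.prems
  obtain v v' q where "exec c s v q" "exec (While b c) q v' r" "u = 1 + v + v'"
    by (cases rule: exec_WhileE) (use WhileTrue.hyps in auto)
  with WhileTrue.IH show ?case by metis
qed (auto elim: exec_SkipE exec_StoreE)

primrec aexp_growth :: "aexp \<Rightarrow> nat" where
  "aexp_growth (Const k) = k"
| "aexp_growth (Get a e) = 0"
| "aexp_growth (Inc e) = aexp_growth e + 1"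
| "aexp_growth (Dec e) = aexp_growth e"

primrec com_growth :: "com \<Rightarrow> nat" where
  "com_growth Skip = 0"
| "com_growth (Store a i e) = aexp_growth e"
| "com_growth (Seq c d) = max (com_growth c) (com_growth d)"
| "com_growth (Cond b c d) = max (com_growth c) (com_growth d)"
| "com_growth (While b c) = com_growth c"

lemma aval_growth: "\<forall>a i. s a i \<le> M \<Longrightarrow> aval e s \<le> M + aexp_growth e"
  by (induction e) auto

lemma exec_growth:
  assumes "exec c s t s'" and "\<forall>a i. s a i \<le> M" and "com_growth c \<le> B"
  shows "\<forall>a i. s' a i \<le> M + B * t"
  using assms
proof (induction arbitrary: M rule: exec.induct)
  case (Skip s)
  then show ?case by (simp add: trans_le_add1)
next
  case (Store a i e s)
  then have "aval e s \<le> M + B"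
    using aval_growth[of s M e] by simp
  with Store.prems(1) show ?case by (simp add: trans_le_add1)
next
  case (Seq c s t s' d t' s'')
  then have "\<forall>a i. s'' a i \<le> (M + B * t) + B * t'" by simp
  then show ?case by (simp add: distrib_left ac_simps)
next
  case (CondTrue b s c t s' d)
  then have "\<forall>a i. s' a i \<le> M + B * t" by simp
  then show ?case by (simp add: trans_le_add2 add.left_commute)
next
  case (CondFalse b s d t s' c)
  then have "\<forall>a i. s' a i \<le> M + B * t" by simp
  then show ?case by (simp add: trans_le_add2 add.left_commute)
next
  case (WhileFalse b s c)
  then show ?case by (simp add: trans_le_add1)
next
  case (WhileTrue b s c t s' t' s'')
  then have "\<forall>a i. s'' a i \<le> (M + B * t) + B * t'" by simp
  then have "\<forall>a i. s'' a i \<le> B + ((M + B * t) + B * t')" by (simp add: trans_le_add2)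
  then show ?case by (simp add: distrib_left ac_simps)
qed

section \<open>Input and output\<close>

text \<open>The graph is given as an unordered edge list: the vertices are numbered by their positions
  in \<open>vs\<close>, and the entry \<open>(i, j)\<close> of \<open>es\<close> is the edge joining vertices number \<open>i\<close> and \<open>j\<close>.\<close>

definition edge_at :: "'a list \<Rightarrow> (nat \<times> nat) list \<Rightarrow> nat \<Rightarrow> 'a set" where
  "edge_at vs es k = {vs ! fst (es ! k), vs ! snd (es ! k)}"

definition graph_input :: "'a set \<Rightarrow> 'a set set \<Rightarrow> 'a list \<Rightarrow> (nat \<times> nat) list \<Rightarrow> bool" where
  "graph_input V E vs es \<longleftrightarrow>
     distinct vs \<and> set vs = V \<and>
     (\<forall>(i, j)\<in>set es. i < length vs \<and> j < length vs) \<and>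
     bij_betw (edge_at vs es) {..<length es} E"

text \<open>The partition of the edges into \<open>P\<^sub>1\<close> and the rest is given by the labels 1 and 2.\<close>

definition input_memory :: "'a list \<Rightarrow> (nat \<times> nat) list \<Rightarrow> 'a set set \<Rightarrow> memory" where
  "input_memory vs es P\<^sub>1 = (\<lambda>_ _. 0)
     (''n'' := (\<lambda>k. if k = 0 then length vs else 0),
      ''m'' := (\<lambda>k. if k = 0 then length es else 0),
      ''src'' := (\<lambda>k. if k < length es then fst (es ! k) else 0),
      ''tgt'' := (\<lambda>k. if k < length es then snd (es ! k) else 0),
      ''part'' := (\<lambda>k. if k < length es then (if edge_at vs es k \<in> P\<^sub>1 then 1 else 2) else 0))"

definition output_class :: "'a list \<Rightarrow> (nat \<times> nat) list \<Rightarrow> memory \<Rightarrow> nat \<Rightarrow> 'a set set" where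
  "output_class vs es s l = {edge_at vs es k | k. k < length es \<and> s ''out'' k = l}"

end

theory Submission
  imports Defs
begin

text \<open>In each part, grow a breadth-first spanning forest. An edge \<open>uw\<close> outside it, with \<open>u\<close>
  discovered after \<open>w\<close>, closes the only cycle of its component, and this cycle also contains the
  edge from \<open>u\<close> to its parent. Moving one of these two edges to \<open>L\<close> for every such \<open>uw\<close>
  destroys all cycles. The cycles of one part are disjoint, so the edges taken from one part form a
  matching; hence \<open>L\<close> has maximum degree two and its paths alternate. A cycle in \<open>L\<close> is avoided
  by recording for each end of a path of \<open>L\<close> the other end, its mate: if \<open>w\<close> is the mate of \<open>u\<close>,
  then the parent of \<open>u\<close> lies on a different path, so that the parent edge can be taken instead
  of \<open>uw\<close>. This costs constant time per edge.\<close>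

section \<open>Paths, cycles and linear forests\<close>

text \<open>Parents are numbered before their children, so no descendant of \<open>u\<close> has a
  smaller number than \<open>u\<close>. As \<open>w\<close> has one, the tree path from
  \<open>u\<close> to \<open>w\<close> must leave \<open>u\<close> through its parent edge. Two
  edges of the cycle that share \<open>u\<close> are thus known from the numbering alone, without
  walking along the cycle, and this is what makes the time per edge constant. The vertices
  \<open>u\<close>, \<open>w\<close> and the parent of \<open>u\<close> lie on the cycle. Edges
  taken earlier from the same part lie on other, disjoint cycles and miss them; those from the other
  part form a matching. So each of the three vertices meets at most one edge of the current
  \<open>L\<close> and is an end of a path of \<open>L\<close>, possibly of a path with one vertex.
  Adding either candidate joins two ends, and only joining \<open>u\<close> to its own mate would
  close a cycle. No look-ahead is needed: the second part simply starts from the paths that the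
  first one has left. Of the pseudoforest property only one consequence enters: two cycles of a part
  that share a vertex are equal.\<close>

lemma path_edges_Nil [simp]: "path_edges [] = {}"
  and path_edges_single [simp]: "path_edges [x] = {}"
  by (auto simp: path_edges_def)

lemma path_edges_Cons2 [simp]: "path_edges (x # y # zs) = insert {x, y} (path_edges (y # zs))"
  (is "?l = ?r")
proof
  show "?l \<subseteq> ?r"
  proof
    fix e assume "e \<in> ?l"
    then obtain i where i: "Suc i < length (x # y # zs)" "e = {(x # y # zs) ! i, (x # y # zs) ! Suc i}"
      by (auto simp: path_edges_def)
    then show "e \<in> ?r"
      by (cases i) (auto simp: path_edges_def)
  qed
  show "?r \<subseteq> ?l"
    unfolding path_edges_def by (force intro: exI[of _ 0] exI[of _ "Suc _"])
qed

lemma path_edges_append: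
  "xs \<noteq> [] \<Longrightarrow> ys \<noteq> [] \<Longrightarrow>
    path_edges (xs @ ys) = insert {last xs, hd ys} (path_edges xs \<union> path_edges ys)"
proof (induction xs rule: induct_list012)
  case (2 x)
  then show ?case by (cases ys) auto
qed auto

lemma path_edges_rev [simp]: "path_edges (rev xs) = path_edges xs"
proof (induction xs)
  case (Cons x xs)
  show ?case
  proof (cases xs)
    case (Cons y zs)
    then have "path_edges (rev xs @ [x]) = insert {y, x} (path_edges (rev xs))"
      by (subst path_edges_append) (auto simp: last_rev)
    with Cons Cons.IH show ?thesis by (auto simp: insert_commute)
  qed simp
qed simp

lemma path_edges_map: "path_edges (map f xs) = (`) f ` path_edges xs"
  by (induction xs rule: induct_list012) auto

lemma path_edges_subset: "e \<in> path_edges xs \<Longrightarrow> e \<subseteq> set xs"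
  by (auto simp: path_edges_def)

lemma cycle_edges_eq:
  assumes "xs \<noteq> []"
  shows "cycle_edges xs = insert {last xs, hd xs} (path_edges xs)"
proof -
  let ?n = "length xs"
  have "cycle_edges xs = (\<lambda>i. {xs ! i, xs ! (Suc i mod ?n)}) ` {..<?n}"
    by (auto simp: cycle_edges_def)
  also have "{..<?n} = insert (?n - 1) {i. Suc i < ?n}"
    using assms by (cases "length xs") (auto simp: less_Suc_eq)
  also have "(\<lambda>i. {xs ! i, xs ! (Suc i mod ?n)}) ` \<dots> =
      insert {last xs, hd xs} ((\<lambda>i. {xs ! i, xs ! Suc i}) ` {i. Suc i < ?n})"
    using assms by (auto simp: last_conv_nth hd_conv_nth)
  finally show ?thesis by (auto simp: path_edges_def)
qed

lemma Union_cycle_edges: "\<Union>(cycle_edges xs) = set xs"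
proof
  show "\<Union>(cycle_edges xs) \<subseteq> set xs"
  proof
    fix x assume "x \<in> \<Union>(cycle_edges xs)"
    then obtain i where "i < length xs" "x = xs ! i \<or> x = xs ! (Suc i mod length xs)"
      by (auto simp: cycle_edges_def)
    moreover from this have "Suc i mod length xs < length xs" by (intro mod_less_divisor) auto
    ultimately show "x \<in> set xs" by auto
  qed
  show "set xs \<subseteq> \<Union>(cycle_edges xs)"
    unfolding cycle_edges_def in_set_conv_nth by (clarsimp simp: subset_iff in_set_conv_nth) blast
qed

lemma cycles_mono: "F \<subseteq> G \<Longrightarrow> cycles F \<subseteq> cycles G"
  unfolding cycles_def
proof (intro Collect_mono impI, elim exE conjE)
  fix C :: "'a set set" and xs :: "'a list"
  assume xs: "C = cycle_edges xs" "distinct xs" "3 \<le> length xs" and "cycle_edges xs \<subseteq> F" "F \<subseteq> G"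
  then have "cycle_edges xs \<subseteq> G" by simp
  with xs show "\<exists>xs. C = cycle_edges xs \<and> distinct xs \<and> 3 \<le> length xs \<and> cycle_edges xs \<subseteq> G"
    by (intro exI[of _ xs] conjI)
qed

section \<open>Connectivity and acyclicity criteria\<close>

lemma reachable_refl [simp]: "reachable F x x"
  and reachable_edge: "{x, y} \<in> F \<Longrightarrow> reachable F x y"
  and reachable_trans: "reachable F x y \<Longrightarrow> reachable F y z \<Longrightarrow> reachable F x z"
  by (auto simp: reachable_def)

lemma reachable_sym: "reachable F x y \<Longrightarrow> reachable F y x"
  unfolding reachable_def
proof (induction rule: rtranclp_induct)
  case (step y z)
  then have "{z, y} \<in> F" by (simp add: insert_commute)
  with step.IH show ?case by (meson converse_rtranclp_into_rtranclp)
qed simp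

lemma path_reachable:
  assumes "path_edges xs \<subseteq> F" "x \<in> set xs" "y \<in> set xs"
  shows "reachable F x y"
proof -
  have "reachable F (hd xs) z" if "z \<in> set xs" "path_edges xs \<subseteq> F" for z
    using that
    by (induction xs arbitrary: z rule: induct_list012)
      (auto dest: reachable_edge intro: reachable_trans)
  with assms show ?thesis by (meson reachable_sym reachable_trans)
qed

lemma cycle_reachable:
  assumes "C \<in> cycles F" "x \<in> \<Union>C" "y \<in> \<Union>C"
  shows "reachable F x y"
proof -
  from assms(1) obtain xs where xs: "C = cycle_edges xs" "C \<subseteq> F" "xs \<noteq> []"
    unfolding cycles_def by force
  then have "path_edges xs \<subseteq> F" by (auto simp: cycle_edges_eq)
  with assms xs show ?thesis by (metis Union_cycle_edges path_reachable)
qed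

text \<open>A cycle is connected and therefore lies in the component of each of its vertices, so
  both cycles lie in the component of \<open>x\<close>.\<close>

lemma pseudoforest_cycles_eq:
  assumes "pseudoforest V F" "C \<in> cycles F" "D \<in> cycles F" "x \<in> \<Union>C" "x \<in> \<Union>D" "x \<in> V"
  shows "C = D"
proof -
  let ?K = "{u. reachable F x u}"
  have "?K \<in> components V F" using assms(6) by (auto simp: components_def)
  moreover have "\<Union>C \<subseteq> ?K" "\<Union>D \<subseteq> ?K"
    using cycle_reachable[OF assms(2,4)] cycle_reachable[OF assms(3,5)] by auto
  ultimately show ?thesis using assms(1-3) unfolding pseudoforest_def by blast
qed

text \<open>The vertex of largest number on a cycle would have two distinct neighbours of smaller
  number, its successor and its predecessor.\<close>

lemma forestI:
  fixes num :: "'a \<Rightarrow> nat"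
  assumes ne: "\<And>x y. {x, y} \<in> F \<Longrightarrow> num x \<noteq> num y"
    and unique: "\<And>x y z. {x, y} \<in> F \<Longrightarrow> {x, z} \<in> F \<Longrightarrow> num y < num x \<Longrightarrow> num z < num x \<Longrightarrow> y = z"
  shows "forest F"
proof (rule ccontr)
  assume "\<not> forest F"
  then obtain xs where xs: "distinct xs" "3 \<le> length xs" "cycle_edges xs \<subseteq> F"
    by (auto simp: forest_def cycles_def)
  let ?n = "length xs"
  let ?m = "Max (num ` set xs)"
  have "?m \<in> num ` set xs" using xs(2) by (intro Max_in) auto
  then obtain i where i: "i < ?n" "num (xs ! i) = ?m"
    by (metis (no_types, lifting) image_iff in_set_conv_nth)
  have max: "num (xs ! j) \<le> num (xs ! i)" if "j < ?n" for j
    using i that by simp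
  define j where "j = Suc i mod ?n"
  \<comment> \<open>The cyclic predecessor of \<open>i\<close>; it differs from the successor
    \<open>j\<close> because the cycle has at least three vertices.\<close>
  define k where "k = (if i = 0 then ?n - 1 else i - 1)"
  have jk: "j < ?n" "k < ?n" "j \<noteq> k" "Suc k mod ?n = i"
    using i(1) xs(2) by (auto simp: j_def k_def mod_Suc)
  have "{xs ! i, xs ! j} \<in> F" "{xs ! k, xs ! i} \<in> F"
    using xs(3) i(1) jk unfolding cycle_edges_def j_def by blast+
  then have e: "{xs ! i, xs ! j} \<in> F" "{xs ! i, xs ! k} \<in> F"
    by (simp_all add: insert_commute)
  then have "num (xs ! j) < num (xs ! i)" "num (xs ! k) < num (xs ! i)"
    using ne max jk by (metis le_neq_implies_less)+
  with e have "xs ! j = xs ! k" using unique by blast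
  with xs jk show False by (simp add: nth_eq_iff_index_eq)
qed

text \<open>A local form of \<open>is_path_of\<close>: no edge leaves the path or is a chord of it.
  Reachability does not occur, so the property can be checked edge by edge when an edge is
  inserted.\<close>

definition component_path :: "'a set set \<Rightarrow> 'a list \<Rightarrow> bool" where
  "component_path F xs \<longleftrightarrow> xs \<noteq> [] \<and> distinct xs \<and> path_edges xs \<subseteq> F \<and>
     (\<forall>e\<in>F. e \<inter> set xs \<noteq> {} \<longrightarrow> e \<in> path_edges xs)"

lemma component_path_reachable:
  assumes "component_path F xs" "x \<in> set xs"
  shows "{y. reachable F x y} = set xs"
proof
  show "set xs \<subseteq> {y. reachable F x y}"
    using path_reachable[of xs F x] assms by (auto simp: component_path_def)
  have "y \<in> set xs" if "reachable F x y" for y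
    using that unfolding reachable_def
  proof (induction rule: rtranclp_induct)
    case (step y z)
    then have "{y, z} \<in> path_edges xs" using assms(1) by (auto simp: component_path_def)
    then show ?case using path_edges_subset by blast
  qed (use assms in simp)
  then show "{y. reachable F x y} \<subseteq> set xs" by blast
qed

lemma component_path_unique:
  assumes "component_path F xs" "component_path F ys" "x \<in> set xs" "x \<in> set ys"
  shows "set xs = set ys"
  using assms component_path_reachable by metis

lemma component_path_rev: "component_path F (rev xs) = component_path F xs"
  by (simp add: component_path_def)

text \<open>Carries the paths from vertex numbers, on which the program works, to the vertices.
  Injectivity prevents the image of a foreign edge from touching the image of the path.\<close>

lemma component_path_map:
  assumes "component_path F xs" "inj_on f A" "set xs \<subseteq> A" "\<Union>F \<subseteq> A"
  shows "component_path ((`) f ` F) (map f xs)"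
proof -
  have "f ` e \<in> path_edges (map f xs)" if "e \<in> F" "f ` e \<inter> f ` set xs \<noteq> {}" for e
  proof -
    from that(2) obtain a b where ab: "a \<in> e" "b \<in> set xs" "f a = f b" by auto
    with assms that have "a = b" by (meson UnionI inj_onD subsetD)
    with ab that assms(1) have "e \<in> path_edges xs" by (auto simp: component_path_def)
    then show ?thesis by (simp add: path_edges_map)
  qed
  with assms show ?thesis
    by (auto simp: component_path_def path_edges_map distinct_map intro: inj_on_subset)
qed

text \<open>Numbered by position, a vertex has only its predecessor as a smaller neighbour, so
  \<open>forestI\<close> applies.\<close>

lemma forest_path:
  assumes "distinct xs"
  shows "forest (path_edges xs)"
proof -
  define num where "num = (\<lambda>x. THE i. i < length xs \<and> xs ! i = x)"
  have num: "num (xs ! i) = i" if "i < length xs" for i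
    unfolding num_def using that assms by (intro the_equality) (auto simp: nth_eq_iff_index_eq)
  have E: "\<exists>i. Suc i < length xs \<and> (x = xs ! i \<and> y = xs ! Suc i \<or> y = xs ! i \<and> x = xs ! Suc i)"
    if "{x, y} \<in> path_edges xs" for x y
    using that by (auto simp: path_edges_def doubleton_eq_iff)
  show ?thesis
  proof (rule forestI[of _ num])
    fix x y assume "{x, y} \<in> path_edges xs"
    from E[OF this] show "num x \<noteq> num y" by (auto simp: num)
  next
    fix x y z
    assume "{x, y} \<in> path_edges xs" "{x, z} \<in> path_edges xs"
      and less: "num y < num x" "num z < num x"
    then obtain i j where
      i: "Suc i < length xs" "x = xs ! i \<and> y = xs ! Suc i \<or> y = xs ! i \<and> x = xs ! Suc i" and
      j: "Suc j < length xs" "x = xs ! j \<and> z = xs ! Suc j \<or> z = xs ! j \<and> x = xs ! Suc j"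
      using E by metis
    from i less(1) have x: "x = xs ! Suc i" "y = xs ! i" by (auto simp: num)
    from j less(2) have z: "x = xs ! Suc j" "z = xs ! j" by (auto simp: num)
    have "Suc i = num x" unfolding x(1) num[OF i(1)] ..
    moreover have "Suc j = num x" unfolding z(1) num[OF j(1)] ..
    ultimately have "i = j" by simp
    with x(2) z(2) show "y = z" by simp
  qed
qed

text \<open>A cycle stays inside one component and would be a cycle of the path that fills it. The
  empty edge is excluded because it meets no path and yet is a subset of every component.\<close>

lemma linear_forestI:
  assumes "\<And>x. x \<in> V \<Longrightarrow> \<exists>xs. x \<in> set xs \<and> component_path F xs" "\<Union>F \<subseteq> V" "{} \<notin> F"
  shows "linear_forest V F"
  unfolding linear_forest_def
proof
  show "forest F"
  proof (rule ccontr)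
    assume "\<not> forest F"
    then obtain cs where cs: "distinct cs" "3 \<le> length cs" "cycle_edges cs \<subseteq> F"
      by (auto simp: forest_def cycles_def)
    then have mem: "cycle_edges cs \<in> cycles F" by (auto simp: cycles_def)
    have hd: "hd cs \<in> set cs" using cs by (cases cs) auto
    then have "hd cs \<in> V" using cs(3) assms(2) Union_cycle_edges[of cs] by blast
    then obtain xs where xs: "hd cs \<in> set xs" "component_path F xs" using assms(1) by blast
    have sub: "set cs \<subseteq> set xs"
      using cycle_reachable[OF mem, of "hd cs"] component_path_reachable[OF xs(2,1)] hd
      by (auto simp: Union_cycle_edges)
    have "cycle_edges cs \<subseteq> path_edges xs"
    proof
      fix e assume e: "e \<in> cycle_edges cs"
      then have "e \<subseteq> set xs" "e \<in> F" "e \<noteq> {}"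
        using sub cs(3) assms(3) Union_cycle_edges[of cs] by blast+
      then show "e \<in> path_edges xs" using xs(2) by (auto simp: component_path_def)
    qed
    then have "cycle_edges cs \<in> cycles (path_edges xs)" using cs by (auto simp: cycles_def)
    then show False using forest_path xs(2) by (auto simp: component_path_def forest_def)
  qed
  show "\<forall>K\<in>components V F. \<exists>xs. is_path_of F K xs"
  proof
    fix K assume "K \<in> components V F"
    then obtain x where x: "x \<in> V" "K = {y. reachable F x y}" by (auto simp: components_def)
    then obtain xs where xs: "x \<in> set xs" "component_path F xs" using assms(1) by blast
    have K: "K = set xs" using component_path_reachable[OF xs(2,1)] x by simp
    have "{e \<in> F. e \<subseteq> K} = path_edges xs"
    proof
      show "{e \<in> F. e \<subseteq> K} \<subseteq> path_edges xs"
      proof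
        fix e assume e: "e \<in> {e \<in> F. e \<subseteq> K}"
        with assms(3) have "e \<noteq> {}" by auto
        with e show "e \<in> path_edges xs" using xs(2) K by (auto simp: component_path_def)
      qed
      show "path_edges xs \<subseteq> {e \<in> F. e \<subseteq> K}"
        using xs(2) K by (auto simp: component_path_def dest: path_edges_subset)
    qed
    with xs K show "\<exists>xs. is_path_of F K xs" by (auto simp: is_path_of_def component_path_def)
  qed
qed

text \<open>The map \<open>mate\<close> is meaningful only at the end vertices of the paths.\<close>

definition mated_paths :: "'a set \<Rightarrow> 'a set set \<Rightarrow> ('a \<Rightarrow> 'a) \<Rightarrow> bool" where
  "mated_paths V F mate \<longleftrightarrow> (\<forall>x\<in>V. \<exists>xs. x \<in> set xs \<and> set xs \<subseteq> V \<and> component_path F xs \<and>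
     mate (hd xs) = last xs \<and> mate (last xs) = hd xs)"

text \<open>An inner vertex has two distinct incident edges, one to each neighbour on the
  path.\<close>

lemma component_path_end:
  assumes xs: "component_path F xs" "x \<in> set xs" and card: "card {e \<in> F. x \<in> e} \<le> 1" and "finite F"
  shows "x = hd xs \<or> x = last xs"
proof (rule ccontr)
  assume no: "\<not> ?thesis"
  from xs have xs': "xs \<noteq> []" "distinct xs" by (auto simp: component_path_def)
  from xs(2) obtain i where i: "i < length xs" "x = xs ! i" by (auto simp: in_set_conv_nth)
  have "i \<noteq> 0" "Suc i \<noteq> length xs"
    using no i xs'(1) by (metis hd_conv_nth, metis last_conv_nth diff_Suc_1)
  with i obtain j where j: "i = Suc j" "Suc i < length xs" by (cases i) auto
  let ?e = "{xs ! j, xs ! i}" and ?d = "{xs ! i, xs ! Suc i}"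
  have "?e \<in> path_edges xs" "?d \<in> path_edges xs" using i j by (auto simp: path_edges_def)
  then have sub: "{?e, ?d} \<subseteq> {e \<in> F. x \<in> e}" using xs i by (auto simp: component_path_def)
  have "?e \<noteq> ?d" using xs'(2) i j by (auto simp: doubleton_eq_iff nth_eq_iff_index_eq)
  then have "card {?e, ?d} = 2" by simp
  moreover have "card {?e, ?d} \<le> card {e \<in> F. x \<in> e}"
    using sub assms(4) by (intro card_mono) auto
  ultimately show False using card by simp
qed

text \<open>The condition on \<open>mate\<close> is symmetric in the two ends, so the path may be
  reversed; with \<open>x\<close> in last position it is ready to be concatenated.\<close>

lemma mated_paths_endE:
  assumes "mated_paths V F mate" "x \<in> V" "card {e \<in> F. x \<in> e} \<le> 1" "finite F"
  obtains xs where "component_path F xs" "set xs \<subseteq> V" "last xs = x" "mate x = hd xs"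
proof -
  from assms(1,2) obtain xs where xs: "x \<in> set xs" "set xs \<subseteq> V" "component_path F xs"
    "mate (hd xs) = last xs" "mate (last xs) = hd xs"
    unfolding mated_paths_def by blast
  consider "x = last xs" | "x = hd xs" using component_path_end[OF xs(3,1) assms(3,4)] by blast
  then show ?thesis
  proof cases
    case 1
    with xs that[of xs] show ?thesis by simp
  next
    case 2
    with xs that[of "rev xs"] show ?thesis
      by (simp add: component_path_rev hd_rev last_rev component_path_def)
  qed
qed

text \<open>The new path is \<open>xs @ ys\<close>. Its ends \<open>mate u\<close> and
  \<open>mate w\<close> become mates of each other; all other paths are disjoint from both and keep
  their entries. If \<open>u\<close> or \<open>w\<close> becomes an inner vertex, its old entry may
  stay, since only ends are ever read.\<close>

lemma mated_paths_join:
  assumes inv: "mated_paths V F mate"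
    and xs: "component_path F xs" "set xs \<subseteq> V" "last xs = u" "mate u = hd xs"
    and ys: "component_path F ys" "set ys \<subseteq> V" "hd ys = w" "mate w = last ys"
    and disj: "set xs \<inter> set ys = {}"
  shows "mated_paths V (insert {u, w} F) (mate(mate u := mate w, mate w := mate u))"
proof -
  let ?F = "insert {u, w} F" and ?mate = "mate(mate u := mate w, mate w := mate u)"
  have ne: "xs \<noteq> []" "ys \<noteq> []" using xs ys by (auto simp: component_path_def)
  have uw: "u \<in> set xs" "w \<in> set ys" "hd xs \<in> set xs" "last ys \<in> set ys"
    using ne xs(3) ys(3) by auto
  show ?thesis
    unfolding mated_paths_def
  proof
    fix x assume x: "x \<in> V"
    show "\<exists>zs. x \<in> set zs \<and> set zs \<subseteq> V \<and> component_path ?F zs \<and>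
      ?mate (hd zs) = last zs \<and> ?mate (last zs) = hd zs"
    proof (cases "x \<in> set xs \<union> set ys")
      case True
      have "component_path ?F (xs @ ys)"
        using xs ys disj ne unfolding component_path_def by (auto simp: path_edges_append)
      moreover have "?mate (hd (xs @ ys)) = last (xs @ ys)" "?mate (last (xs @ ys)) = hd (xs @ ys)"
        using ne xs(4) ys(4) uw disj by auto
      ultimately show ?thesis using True xs(2) ys(2) by (intro exI[of _ "xs @ ys"]) auto
    next
      case False
      from inv x obtain zs where zs: "x \<in> set zs" "set zs \<subseteq> V" "component_path F zs"
        "mate (hd zs) = last zs" "mate (last zs) = hd zs"
        unfolding mated_paths_def by blast
      have d: "set zs \<inter> set xs = {}" "set zs \<inter> set ys = {}"
        using False zs(1) component_path_unique[OF zs(3) xs(1)] component_path_unique[OF zs(3) ys(1)]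
        by auto
      then have "component_path ?F zs"
        using zs(3) uw by (auto simp: component_path_def)
      moreover have "hd zs \<in> set zs" "last zs \<in> set zs"
        using zs(1) by (cases zs; auto)+
      then have "?mate (hd zs) = last zs" "?mate (last zs) = hd zs"
        using d uw zs(4,5) xs(4) ys(4) by auto
      ultimately show ?thesis using zs(1,2) by blast
    qed
  qed
qed

text \<open>At most one of two edges sharing the vertex \<open>u\<close> can close a cycle: its other end vertex
  is then the mate of \<open>u\<close>.\<close>

lemma mated_paths_insert:
  assumes inv: "mated_paths V F mate" and fin: "finite F"
    and end_: "\<And>x. x \<in> {u, w, z} \<Longrightarrow> x \<in> V \<and> card {e \<in> F. x \<in> e} \<le> 1"
    and ne: "u \<noteq> w" "u \<noteq> z" "w \<noteq> z"
  defines "y \<equiv> if mate u = w then z else w"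
  shows "mated_paths V (insert {u, y} F) (mate(mate u := mate y, mate y := mate u))"
proof -
  obtain xs where xs: "component_path F xs" "set xs \<subseteq> V" "last xs = u" "mate u = hd xs"
    using mated_paths_endE[OF inv _ _ fin, of u] end_ by blast
  obtain ys where ys: "component_path F ys" "set ys \<subseteq> V" "last ys = y" "mate y = hd ys"
    using mated_paths_endE[OF inv _ _ fin, of y] end_ by (auto simp: y_def)
  have nonempty: "xs \<noteq> []" "ys \<noteq> []" using xs ys by (auto simp: component_path_def)
  have "set xs \<inter> set ys = {}"
  proof (rule ccontr)
    assume "set xs \<inter> set ys \<noteq> {}"
    then obtain a where "a \<in> set xs" "a \<in> set ys" by blast
    then have "set xs = set ys" by (rule component_path_unique[OF xs(1) ys(1)])
    with last_in_set[OF nonempty(2)] ys(3) have "y \<in> set xs" by simp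
    \<comment> \<open>Both ends are impossible: the last vertex is \<open>u\<close>, and the first
      one is \<open>mate u\<close>, which the choice of \<open>y\<close> avoids.\<close>
    then have "y = hd xs \<or> y = last xs"
      using component_path_end[OF xs(1) _ _ fin] end_ by (simp add: y_def)
    with xs(3,4) ne show False unfolding y_def by (simp split: if_splits)
  qed
  then show ?thesis
    using mated_paths_join[OF inv xs, of "rev ys" y] ys nonempty
    by (simp add: component_path_rev hd_rev last_rev)
qed

section \<open>Reasoning about running times\<close>

text \<open>Total correctness with a step count. Asking for one terminating run suffices, since
  execution is deterministic.\<close>

definition wp :: "com \<Rightarrow> (nat \<Rightarrow> memory \<Rightarrow> bool) \<Rightarrow> memory \<Rightarrow> bool" where
  "wp c Q s \<longleftrightarrow> (\<exists>t s'. exec c s t s' \<and> Q t s')"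

lemma wp_Skip [simp]: "wp Skip Q s = Q 1 s"
  unfolding wp_def by (metis exec.Skip exec_SkipE)

lemma wp_Store [simp]: "wp (Store a i e) Q s = Q 1 (s(a := (s a)(aval i s := aval e s)))"
  unfolding wp_def by (metis exec.Store exec_StoreE)

lemma wp_Seq [simp]: "wp (Seq c d) Q s = wp c (\<lambda>t. wp d (\<lambda>t'. Q (t + t'))) s"
  unfolding wp_def by (metis exec.Seq exec_SeqE)

lemma wp_Cond [simp]:
  "wp (Cond b c d) Q s = (if bval b s then wp c (\<lambda>t. Q (1 + t)) s else wp d (\<lambda>t. Q (1 + t)) s)"
  proof -
  have "exec (Cond b c d) s t s' \<longleftrightarrow> (\<exists>t'. t = 1 + t' \<and> exec (if bval b s then c else d) s t' s')" for t s'
    by (auto intro: exec.CondTrue[simplified] exec.CondFalse[simplified] elim!: exec_CondE)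
  then show ?thesis unfolding wp_def by auto
qed

lemma wp_mono: "wp c Q s \<Longrightarrow> (\<And>t s'. Q t s' \<Longrightarrow> R t s') \<Longrightarrow> wp c R s"
  unfolding wp_def by blast

text \<open>The number \<open>T\<close> is a budget: \<open>I T s\<close> means that it covers the remaining iterations.\<close>

lemma wp_While:
  assumes step: "\<And>T s. I T s \<Longrightarrow> bval b s \<Longrightarrow> wp c (\<lambda>t s'. \<exists>T'. I T' s' \<and> T' + t < T) s"
    and "I T s"
  shows "wp (While b c) (\<lambda>t s'. t \<le> T + 1 \<and> \<not> bval b s' \<and> (\<exists>T'. I T' s')) s"
  using \<open>I T s\<close>
proof (induction T arbitrary: s rule: less_induct)
  case (less T)
  show ?case
  proof (cases "bval b s")
    case False
    with less.prems show ?thesis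
      unfolding wp_def by (metis exec.WhileFalse le_add2)
  next
    case True
    from step[OF less.prems True] obtain t s' T' where
      c: "exec c s t s'" "I T' s'" "T' + t < T" by (auto simp: wp_def)
    with less.IH[of T' s'] obtain t' s'' where
      "exec (While b c) s' t' s''" "t' \<le> T' + 1" "\<not> bval b s''" "\<exists>T'. I T' s''"
      by (auto simp: wp_def)
    with c True show ?thesis
      unfolding wp_def
      by (intro exI[of _ "1 + t + t'"] exI[of _ s'']) (auto intro: exec.WhileTrue[simplified])
  qed
qed

abbreviation Var :: "string \<Rightarrow> aexp" where
  "Var x \<equiv> Get x (Const 0)"

abbreviation Assign :: "string \<Rightarrow> aexp \<Rightarrow> com" where
  "Assign x \<equiv> Store x (Const 0)"

text \<open>The budget is \<open>(B + 1) * (N - i)\<close>: each remaining iteration pays for its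
  body and its test. The final \<open>+ 1\<close> is the failing test. The invariant has to keep the
  limit \<open>y\<close> fixed.\<close>

lemma wp_count:
  assumes step: "\<And>i s. i < N \<Longrightarrow> s x 0 = i \<Longrightarrow> I i s \<Longrightarrow>
      wp c (\<lambda>t s'. t \<le> B \<and> s' x 0 = Suc i \<and> I (Suc i) s') s"
    and bound: "\<And>i s. I i s \<Longrightarrow> s y 0 = N"
    and "s x 0 = 0" "I 0 s"
  shows "wp (While (Less (Var x) (Var y)) c) (\<lambda>t s'. t \<le> (B + 1) * N + 1 \<and> I N s') s"
proof -
  define J where "J T s \<longleftrightarrow> (\<exists>i\<le>N. s x 0 = i \<and> I i s \<and> T = (B + 1) * (N - i))" for T s
  have "wp (While (Less (Var x) (Var y)) c)
    (\<lambda>t s'. t \<le> (B + 1) * N + 1 \<and> \<not> bval (Less (Var x) (Var y)) s' \<and> (\<exists>T'. J T' s')) s"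
  proof (rule wp_While)
    show "J ((B + 1) * N) s" using assms(3,4) by (auto simp: J_def)
  next
    fix T s assume "J T s" and b: "bval (Less (Var x) (Var y)) s"
    then obtain i where i: "i < N" "s x 0 = i" "I i s" "T = (B + 1) * (N - i)"
      using bound by (fastforce simp: J_def)
    show "wp c (\<lambda>t s'. \<exists>T'. J T' s' \<and> T' + t < T) s"
    proof (rule wp_mono[OF step[OF i(1-3)]], elim conjE)
      fix t s' assume "t \<le> B" "s' x 0 = Suc i" "I (Suc i) s'"
      moreover have "N - i = Suc (N - Suc i)" using i(1) by simp
      ultimately show "\<exists>T'. J T' s' \<and> T' + t < T"
        using i(1,4) by (intro exI[of _ "(B + 1) * (N - Suc i)"]) (auto simp: J_def)
    qed
  qed
  then show ?thesis
  proof (rule wp_mono, elim conjE exE)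
    fix t s' T' assume *: "t \<le> (B + 1) * N + 1" "\<not> bval (Less (Var x) (Var y)) s'" "J T' s'"
    then obtain i where "i \<le> N" "s' x 0 = i" "I i s'" by (auto simp: J_def)
    moreover from this * have "i = N" using bound by fastforce
    ultimately show "t \<le> (B + 1) * N + 1 \<and> I N s'" using * by simp
  qed
qed

section \<open>Fundamental cycles of a spanning forest\<close>

locale indexed_graph =
  fixes n m :: nat and src tgt part :: "nat \<Rightarrow> nat"
  assumes src_less: "k < m \<Longrightarrow> src k < n"
    and tgt_less: "k < m \<Longrightarrow> tgt k < n"
    and no_loop: "k < m \<Longrightarrow> src k \<noteq> tgt k"
    and simple: "k < m \<Longrightarrow> l < m \<Longrightarrow> {src k, tgt k} = {src l, tgt l} \<Longrightarrow> k = l"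
begin

definition ends :: "nat \<Rightarrow> nat set" where
  "ends k = {src k, tgt k}"

definition label_class :: "nat \<Rightarrow> nat set" where
  "label_class p = {k. k < m \<and> part k = p}"

lemma ends_subset: "k < m \<Longrightarrow> ends k \<subseteq> {..<n}"
  by (auto simp: ends_def src_less tgt_less)

lemma label_classD: "k \<in> label_class p \<Longrightarrow> k < m"
  by (simp add: label_class_def)

text \<open>A vertex is the root of its tree iff \<open>root v = v\<close>; only then \<open>par v\<close> and \<open>pe v\<close>,
  the parent and the edge to the parent, are meaningless. Tree edges are marked by \<open>tr k \<noteq> 0\<close>.\<close>

definition spanning ::
    "nat \<Rightarrow> (nat \<Rightarrow> nat) \<Rightarrow> (nat \<Rightarrow> nat) \<Rightarrow> (nat \<Rightarrow> nat) \<Rightarrow> (nat \<Rightarrow> nat) \<Rightarrow> (nat \<Rightarrow> nat) \<Rightarrow> bool" where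
  "spanning p num root par pe tr \<longleftrightarrow>
     inj_on num {..<n} \<and>
     (\<forall>v<n. root v < n \<and> num (root v) \<le> num v \<and>
        (root v \<noteq> v \<longrightarrow> par v < n \<and> num (par v) < num v \<and> root (par v) = root v \<and>
          pe v \<in> label_class p \<and> tr (pe v) \<noteq> 0 \<and> ends (pe v) = {v, par v})) \<and>
     (\<forall>k\<in>label_class p. tr k \<noteq> 0 \<longrightarrow> (\<exists>v<n. root v \<noteq> v \<and> pe v = k)) \<and>
     (\<forall>k\<in>label_class p. root (src k) = root (tgt k))"

definition tree_edges :: "nat \<Rightarrow> (nat \<Rightarrow> nat) \<Rightarrow> nat set" where
  "tree_edges p tr = {k \<in> label_class p. tr k \<noteq> 0}"

definition nontree :: "nat \<Rightarrow> (nat \<Rightarrow> nat) \<Rightarrow> nat set" where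
  "nontree p tr = {k \<in> label_class p. tr k = 0}"

text \<open>"Top" refers to the numbering, not to the height in the tree: \<open>top_end\<close> has
  the larger number and hence is never an ancestor of the other end.\<close>

definition top_end :: "(nat \<Rightarrow> nat) \<Rightarrow> nat \<Rightarrow> nat" where
  "top_end num k = (if num (src k) < num (tgt k) then tgt k else src k)"

definition bot_end :: "(nat \<Rightarrow> nat) \<Rightarrow> nat \<Rightarrow> nat" where
  "bot_end num k = (if num (src k) < num (tgt k) then src k else tgt k)"

lemma ends_top_bot: "ends k = {top_end num k, bot_end num k}"
  by (auto simp: ends_def top_end_def bot_end_def)

text \<open>A root has the least number in its tree, and \<open>w\<close> has a smaller number than
  \<open>u\<close> in the same tree.\<close>

lemma spanning_not_root:
  assumes S: "spanning p num root par pe tr"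
    and "u < n" "w < n" "root u = root w" "num w < num u"
  shows "root u \<noteq> u"
  using assms unfolding spanning_def by (metis leD)

text \<open>Replace the end of larger number by its parent until the ends meet; the sum of the two
  numbers decreases. All later vertices have numbers below \<open>num u\<close>, so \<open>u\<close>
  is not visited again.\<close>

lemma spanning_path:
  assumes S: "spanning p num root par pe tr"
    and "u < n" "w < n" "root u = root w" "num w < num u"
  shows "\<exists>ys. distinct (u # ys) \<and> ys \<noteq> [] \<and> hd ys = par u \<and> last ys = w \<and>
    (\<forall>y\<in>set ys. y < n \<and> num y < num u) \<and> path_edges (u # ys) \<subseteq> ends ` tree_edges p tr"
  using assms(2-)
proof (induction "num u + num w" arbitrary: u w rule: less_induct)
  case less
  let ?u = "par u"
  have nr: "root u \<noteq> u" using spanning_not_root[OF S less.prems] .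
  with S less.prems(1) have u: "?u < n" "num ?u < num u" "root ?u = root u" "pe u \<in> label_class p"
    "tr (pe u) \<noteq> 0" "ends (pe u) = {u, ?u}"
    unfolding spanning_def by blast+
  then have edge: "{u, ?u} \<in> ends ` tree_edges p tr"
    unfolding tree_edges_def by (metis (mono_tags, lifting) imageI mem_Collect_eq)
  show ?case
  proof (cases "num ?u" "num w" rule: linorder_cases)
    case equal
    with S u(1) less.prems(2) have "?u = w" by (auto simp: spanning_def inj_on_def)
    with u edge show ?thesis by (intro exI[of _ "[w]"]) auto
  next
    case greater
    with less.hyps[of ?u w] u less.prems obtain ys where ys: "distinct (?u # ys)" "ys \<noteq> []"
      "last ys = w" "\<forall>y\<in>set ys. y < n \<and> num y < num ?u"
      "path_edges (?u # ys) \<subseteq> ends ` tree_edges p tr"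
      by auto
    with u edge show ?thesis by (intro exI[of _ "?u # ys"]) auto
  next
    case less': less
    have "\<exists>ys. distinct (w # ys) \<and> ys \<noteq> [] \<and> hd ys = par w \<and> last ys = ?u \<and>
      (\<forall>y\<in>set ys. y < n \<and> num y < num w) \<and> path_edges (w # ys) \<subseteq> ends ` tree_edges p tr"
      using u less' less.prems by (intro less.hyps) auto
    then obtain ys where ys: "distinct (w # ys)" "ys \<noteq> []" "last ys = ?u"
      "\<forall>y\<in>set ys. y < n \<and> num y < num w" "path_edges (w # ys) \<subseteq> ends ` tree_edges p tr"
      by blast
    \<comment> \<open>Here \<open>par u\<close> is numbered below \<open>w\<close>, so the induction
      hypothesis was applied with \<open>w\<close> as the later end; its path is reversed to start
      at \<open>par u\<close>.\<close>
    let ?zs = "rev (w # ys)"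
    have "path_edges (u # ?zs) = insert {u, hd ?zs} (path_edges ?zs)"
      using path_edges_append[of "[u]" ?zs] by simp
    moreover have hd: "hd ?zs = ?u" using ys by (simp add: hd_rev)
    ultimately have "path_edges (u # ?zs) \<subseteq> ends ` tree_edges p tr"
      using ys(5) edge path_edges_rev[of "w # ys"] by simp
    with ys u less.prems hd show ?thesis by (intro exI[of _ ?zs]) (auto simp: last_rev)
  qed
qed

end

section \<open>Cycles and spanning forests in terms of the original vertices\<close>

locale labelled_graph = indexed_graph +
  fixes f :: "nat \<Rightarrow> 'a"
  assumes inj_f: "inj_on f {..<n}"
begin

definition edge :: "nat \<Rightarrow> 'a set" where
  "edge k = f ` ends k"

lemma edge_inj: "k < m \<Longrightarrow> l < m \<Longrightarrow> edge k = edge l \<Longrightarrow> k = l"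
  using inj_on_image_eq_iff[OF inj_f ends_subset ends_subset] simple
  by (simp add: edge_def ends_def)

lemma edge_subset: "k < m \<Longrightarrow> edge k \<subseteq> f ` {..<n}"
  using ends_subset by (auto simp: edge_def)

text \<open>\<open>forestI\<close> with the numbering pulled back along \<open>f\<close>: the only
  neighbour of smaller number is the parent.\<close>

lemma tree_edges_forest:
  assumes S: "spanning p num root par pe tr"
  shows "forest (edge ` tree_edges p tr)"
proof -
  define num' where "num' = num \<circ> inv_into {..<n} f"
  have num': "num' (f v) = num v" if "v < n" for v
    using that inj_f by (simp add: num'_def)
  have E: "\<exists>v<n. root v \<noteq> v \<and> par v < n \<and> num (par v) < num v \<and> {x, y} = {f v, f (par v)}"
    if "{x, y} \<in> edge ` tree_edges p tr" for x y
  proof -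
    from that obtain k where k: "k \<in> label_class p" "tr k \<noteq> 0" "{x, y} = edge k"
      by (auto simp: tree_edges_def)
    with S obtain v where v: "v < n" "root v \<noteq> v" "pe v = k" unfolding spanning_def by blast
    moreover from v S have "par v < n" "num (par v) < num v" "ends (pe v) = {v, par v}"
      unfolding spanning_def by blast+
    ultimately show ?thesis using k(3) by (auto simp: edge_def)
  qed
  show ?thesis
  proof (rule forestI[of _ num'])
    fix x y assume "{x, y} \<in> edge ` tree_edges p tr"
    from E[OF this] show "num' x \<noteq> num' y" by (auto simp: doubleton_eq_iff num')
  next
    fix x y z
    assume y: "{x, y} \<in> edge ` tree_edges p tr" "num' y < num' x"
      and z: "{x, z} \<in> edge ` tree_edges p tr" "num' z < num' x"
    from E[OF y(1)] y(2) obtain v where v: "v < n" "x = f v" "y = f (par v)"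
      by (auto simp: doubleton_eq_iff num')
    from E[OF z(1)] z(2) obtain u where u: "u < n" "x = f u" "z = f (par u)"
      by (auto simp: doubleton_eq_iff num')
    from u v inj_f have "u = v" by (auto simp: inj_on_def)
    with u v show "y = z" by simp
  qed
qed

lemma nontree_top:
  assumes S: "spanning p num root par pe tr" and k: "k \<in> nontree p tr"
  shows "top_end num k < n" "bot_end num k < n" "root (top_end num k) = root (bot_end num k)"
    "num (bot_end num k) < num (top_end num k)" "root (top_end num k) \<noteq> top_end num k"
proof -
  have km: "k < m" "k \<in> label_class p" using k by (auto simp: nontree_def label_class_def)
  moreover have "inj_on num {..<n}" using S by (simp add: spanning_def)
  ultimately have "num (src k) \<noteq> num (tgt k)"
    using src_less[of k] tgt_less[of k] no_loop[of k] by (auto dest: inj_onD)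
  with km S show *: "top_end num k < n" "bot_end num k < n"
    "root (top_end num k) = root (bot_end num k)" "num (bot_end num k) < num (top_end num k)"
    using src_less tgt_less by (auto simp: top_end_def bot_end_def spanning_def)
  show "root (top_end num k) \<noteq> top_end num k" by (rule spanning_not_root[OF S *])
qed

text \<open>If the parent of \<open>u\<close> were the other end of \<open>k\<close>, then
  \<open>k\<close> and the parent edge would be parallel and hence equal, but only one of them is a
  tree edge.\<close>

lemma nontree_parent:
  assumes S: "spanning p num root par pe tr" and k: "k \<in> nontree p tr"
  defines "u \<equiv> top_end num k"
  shows "par u < n" "pe u \<in> tree_edges p tr" "ends (pe u) = {u, par u}"
    "par u \<noteq> u" "par u \<noteq> bot_end num k"
proof -
  note top = nontree_top[OF S k, folded u_def]
  with S have P: "par u < n" "num (par u) < num u" "pe u \<in> label_class p" "tr (pe u) \<noteq> 0"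
    "ends (pe u) = {u, par u}"
    unfolding spanning_def by blast+
  then show "par u < n" "pe u \<in> tree_edges p tr" "ends (pe u) = {u, par u}" "par u \<noteq> u"
    by (auto simp: tree_edges_def)
  show "par u \<noteq> bot_end num k"
  proof
    assume "par u = bot_end num k"
    with P have "ends (pe u) = ends k" by (simp add: ends_top_bot[of k num] u_def)
    moreover have "pe u < m" "k < m" using P k by (auto simp: label_class_def nontree_def)
    ultimately have "pe u = k" using simple by (simp add: ends_def)
    with P(4) k show False by (simp add: nontree_def)
  qed
qed

text \<open>The edge \<open>k\<close> closes the path given by \<open>spanning_path\<close>, whose
  first edge is the parent edge. The final inclusion makes \<open>k\<close> the only edge of the
  cycle outside the forest, so that \<open>k\<close> can be recovered from the cycle.\<close>

lemma fundamental_cycle: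
  assumes S: "spanning p num root par pe tr" and k: "k \<in> nontree p tr"
  shows "\<exists>D\<in>cycles (edge ` label_class p). edge k \<in> D \<and> edge (pe (top_end num k)) \<in> D \<and>
    D \<subseteq> insert (edge k) (edge ` tree_edges p tr)"
proof -
  let ?u = "top_end num k" and ?w = "bot_end num k"
  from spanning_path[OF S nontree_top(1-4)[OF S k]]
  obtain ys where ys: "distinct (?u # ys)" "ys \<noteq> []" "hd ys = par ?u" "last ys = ?w"
    "\<forall>y\<in>set ys. y < n \<and> num y < num ?u" "path_edges (?u # ys) \<subseteq> ends ` tree_edges p tr"
    by blast
  let ?xs = "?u # ys"
  let ?D = "cycle_edges (map f ?xs)"
  have "{f ?w, f ?u} = edge k" by (auto simp: edge_def ends_top_bot[of k num])
  then have D: "?D = insert (edge k) ((`) f ` path_edges ?xs)"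
    using ys(2,4) by (simp add: cycle_edges_eq path_edges_map[of f ?xs, simplified] last_map)
  have sub: "(`) f ` path_edges ?xs \<subseteq> edge ` tree_edges p tr"
    using ys(6) by (auto simp: edge_def)
  have "set ?xs \<subseteq> {..<n}" using ys(5) nontree_top(1)[OF S k] by auto
  then have "distinct (map f ?xs)"
    using ys(1) inj_f unfolding distinct_map by (blast intro: inj_on_subset)
  \<comment> \<open>A path of one edge would make the parent of \<open>?u\<close> equal to
    \<open>?w\<close>; thus the cycle has at least three vertices.\<close>
  moreover have "length ys \<noteq> 1"
    using ys(3,4) nontree_parent(5)[OF S k] by (auto simp: length_Suc_conv)
  with ys(2) have "3 \<le> length (map f ?xs)" by (cases ys) (auto simp: Suc_le_eq)
  moreover have "?D \<subseteq> edge ` label_class p"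
    using D sub k by (auto simp: tree_edges_def nontree_def)
  ultimately have "?D \<in> cycles (edge ` label_class p)" unfolding cycles_def by blast
  moreover have "{?u, par ?u} \<in> path_edges ?xs" using ys(2,3) by (cases ys) auto
  then have "edge (pe ?u) \<in> ?D"
    using nontree_parent(3)[OF S k] D unfolding edge_def by (metis imageI insertI2)
  moreover have "edge k \<in> ?D" unfolding D by (rule insertI1)
  moreover have "?D \<subseteq> insert (edge k) (edge ` tree_edges p tr)"
    unfolding D using sub by (rule insert_mono)
  ultimately show ?thesis by (intro bexI[of _ ?D] conjI)
qed

text \<open>The vertices \<open>u\<close>, \<open>w\<close> and \<open>par u\<close>, which contain
  both candidate edges for \<open>k\<close>. Their disjointness for different \<open>k\<close>
  replaces the disjointness of whole cycles, so the cycles need not be stored.\<close>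

definition triple :: "(nat \<Rightarrow> nat) \<Rightarrow> (nat \<Rightarrow> nat) \<Rightarrow> nat \<Rightarrow> nat set" where
  "triple num pe k = ends k \<union> ends (pe (top_end num k))"

lemma fundamental_cycle_triple:
  "v \<in> triple num pe k \<Longrightarrow> edge k \<in> D \<Longrightarrow> edge (pe (top_end num k)) \<in> D \<Longrightarrow> f v \<in> \<Union>D"
  by (auto simp: triple_def edge_def)

lemma class_cycle_eq:
  assumes "pseudoforest (f ` {..<n}) (edge ` label_class p)"
    "C \<in> cycles (edge ` label_class p)" "D \<in> cycles (edge ` label_class p)" "\<Union>C \<inter> \<Union>D \<noteq> {}"
  shows "C = D"
proof -
  from assms(4) obtain x where x: "x \<in> \<Union>C" "x \<in> \<Union>D" by blast
  have "C \<subseteq> edge ` label_class p" using assms(2) by (auto simp: cycles_def)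
  then have "x \<in> f ` {..<n}" using x(1) edge_subset by (fastforce simp: label_class_def)
  then show ?thesis by (rule pseudoforest_cycles_eq[OF assms(1-3) x])
qed

lemma edge_nonempty: "edge k \<noteq> {}"
  by (auto simp: edge_def ends_def)

text \<open>The cycle leaves the forest at some \<open>k\<close>. It shares this edge with the
  fundamental cycle of \<open>k\<close> and hence equals it, so it contains both candidates, and
  either choice destroys it.\<close>

lemma nontree_hits:
  assumes S: "spanning p num root par pe tr"
    and pf: "pseudoforest (f ` {..<n}) (edge ` label_class p)"
    and C: "C \<in> cycles (edge ` label_class p)"
  shows "\<exists>k\<in>nontree p tr. edge k \<in> C \<and> edge (pe (top_end num k)) \<in> C"
proof -
  have "\<not> C \<subseteq> edge ` tree_edges p tr"
    using C tree_edges_forest[OF S] by (auto simp: forest_def cycles_def)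
  then obtain e where e: "e \<in> C" "e \<notin> edge ` tree_edges p tr" by blast
  moreover have "C \<subseteq> edge ` label_class p" using C by (auto simp: cycles_def)
  ultimately obtain k where "k \<in> label_class p" "e = edge k" by blast
  with e have k: "k \<in> nontree p tr" "edge k \<in> C"
    by (auto simp: tree_edges_def nontree_def)
  from fundamental_cycle[OF S k(1)] obtain D where D: "D \<in> cycles (edge ` label_class p)"
    "edge k \<in> D" "edge (pe (top_end num k)) \<in> D" by blast
  have "\<Union>C \<inter> \<Union>D \<noteq> {}" using k(2) D(2) edge_nonempty[of k] by blast
  then have "C = D" by (rule class_cycle_eq[OF pf C D(1)])
  with k D show ?thesis by blast
qed

text \<open>A common vertex would make the two fundamental cycles equal, but each has only one edge
  outside the forest.\<close>

lemma triple_disjoint: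
  assumes S: "spanning p num root par pe tr"
    and pf: "pseudoforest (f ` {..<n}) (edge ` label_class p)"
    and k: "k \<in> nontree p tr" and l: "l \<in> nontree p tr" and "k \<noteq> l"
  shows "triple num pe k \<inter> triple num pe l = {}"
proof (rule ccontr)
  assume "triple num pe k \<inter> triple num pe l \<noteq> {}"
  then obtain v where v: "v \<in> triple num pe k" "v \<in> triple num pe l" by blast
  from fundamental_cycle[OF S k] obtain C where C: "C \<in> cycles (edge ` label_class p)"
    "edge k \<in> C" "edge (pe (top_end num k)) \<in> C" "C \<subseteq> insert (edge k) (edge ` tree_edges p tr)"
    by blast
  from fundamental_cycle[OF S l] obtain D where D: "D \<in> cycles (edge ` label_class p)"
    "edge l \<in> D" "edge (pe (top_end num l)) \<in> D" by blast
  have "f v \<in> \<Union>C" by (rule fundamental_cycle_triple[OF v(1) C(2,3)])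
  moreover have "f v \<in> \<Union>D" by (rule fundamental_cycle_triple[OF v(2) D(2,3)])
  ultimately have "\<Union>C \<inter> \<Union>D \<noteq> {}" by blast
  then have "C = D" by (rule class_cycle_eq[OF pf C(1) D(1)])
  with D(2) C(4) have "edge l = edge k \<or> edge l \<in> edge ` tree_edges p tr" by blast
  moreover have "l < m" "k < m" using k l by (auto simp: nontree_def label_class_def)
  ultimately have "l = k \<or> l \<in> tree_edges p tr"
    using edge_inj by (auto simp: tree_edges_def label_class_def)
  with l \<open>k \<noteq> l\<close> show False by (auto simp: nontree_def tree_edges_def)
qed

end

section \<open>Breadth-first search\<close>

context indexed_graph
begin

text \<open>The adjacency list of \<open>v\<close> once the first \<open>i\<close> edges have been
  entered. New entries come first, as in \<open>add_half_edge\<close>.\<close>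

primrec adj :: "nat \<Rightarrow> nat \<Rightarrow> nat \<Rightarrow> (nat \<times> nat) list" where
  "adj p 0 v = []"
| "adj p (Suc i) v = (if part i = p \<and> v = src i then (tgt i, i) # adj p i v
     else if part i = p \<and> v = tgt i then (src i, i) # adj p i v else adj p i v)"

lemma adj_sound:
  "(w, k) \<in> set (adj p i v) \<Longrightarrow> i \<le> m \<Longrightarrow> k \<in> label_class p \<and> ends k = {v, w}"
  by (induction i) (auto simp: label_class_def ends_def split: if_splits)

lemma adj_complete:
  "k < i \<Longrightarrow> i \<le> m \<Longrightarrow> part k = p \<Longrightarrow> ends k = {v, w} \<Longrightarrow> (w, k) \<in> set (adj p i v)"
proof (induction i)
  case (Suc i)
  then show ?case
    by (cases "k = i") (auto simp: ends_def doubleton_eq_iff)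
qed simp

text \<open>Each edge enters at most two lists. This bounds the total time spent on
  scanning.\<close>

lemma adj_length: "i \<le> m \<Longrightarrow> (\<Sum>v<n. length (adj p i v)) \<le> 2 * i"
proof (induction i)
  case (Suc i)
  let ?d = "\<lambda>v. (if v = src i then 1 else 0) + (if v = tgt i then 1 else 0 :: nat)"
  have "(\<Sum>v<n. length (adj p (Suc i) v)) \<le> (\<Sum>v<n. length (adj p i v) + ?d v)"
    by (intro sum_mono) auto
  also have "\<dots> = (\<Sum>v<n. length (adj p i v)) + 2"
    using Suc.prems src_less[of i] tgt_less[of i] by (simp add: sum.distrib)
  finally show ?case using Suc by simp
qed simp

text \<open>Invariant of the breadth-first search: \<open>num v \<noteq> 0\<close> means that \<open>v\<close> has been discovered,
  \<open>q\<close> is the queue (occupied from \<open>qh\<close> to \<open>qt - 1\<close>), and \<open>ls v\<close> is the part of the adjacency list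
  of \<open>v\<close> that has not been scanned yet. The queued vertices have the same root, since a new tree is
  started only when the queue is empty.\<close>

definition tree_inv :: "nat \<Rightarrow> (nat \<Rightarrow> nat) \<Rightarrow> (nat \<Rightarrow> nat) \<Rightarrow> (nat \<Rightarrow> nat) \<Rightarrow> (nat \<Rightarrow> nat) \<Rightarrow>
    (nat \<Rightarrow> nat) \<Rightarrow> nat \<Rightarrow> bool" where
  "tree_inv p num root par pe tr v \<longleftrightarrow> root v < n \<and> num (root v) \<noteq> 0 \<and> num (root v) \<le> num v \<and>
     (root v \<noteq> v \<longrightarrow> par v < n \<and> num (par v) \<noteq> 0 \<and> num (par v) < num v \<and>
       root (par v) = root v \<and> pe v \<in> label_class p \<and> tr (pe v) \<noteq> 0 \<and> ends (pe v) = {v, par v})"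

text \<open>An edge no longer pending at one of its ends is known to have both ends discovered in
  one tree. Once all lists are empty, this is the last condition of \<open>spanning\<close>. The
  positions in \<open>q\<close> are tied to \<open>num\<close>, so \<open>num v - 1 < qh\<close>
  says that \<open>v\<close> is finished.\<close>

definition search_inv :: "nat \<Rightarrow> (nat \<Rightarrow> nat) \<Rightarrow> (nat \<Rightarrow> nat) \<Rightarrow> (nat \<Rightarrow> nat) \<Rightarrow> (nat \<Rightarrow> nat) \<Rightarrow>
    (nat \<Rightarrow> nat) \<Rightarrow> (nat \<Rightarrow> nat) \<Rightarrow> nat \<Rightarrow> nat \<Rightarrow> nat \<Rightarrow> (nat \<Rightarrow> (nat \<times> nat) list) \<Rightarrow> bool" where
  "search_inv p num root par pe tr q qh qt r ls \<longleftrightarrow>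
     qh \<le> qt \<and> r \<le> n \<and>
     (\<forall>i<qt. q i < n \<and> num (q i) = Suc i) \<and>
     (\<forall>v<n. num v \<noteq> 0 \<longrightarrow> num v \<le> qt \<and> q (num v - 1) = v) \<and>
     (\<forall>v<n. num v \<noteq> 0 \<longrightarrow> tree_inv p num root par pe tr v) \<and>
     (\<forall>k\<in>label_class p. tr k \<noteq> 0 \<longrightarrow> (\<exists>v<n. num v \<noteq> 0 \<and> root v \<noteq> v \<and> pe v = k)) \<and>
     (\<forall>i j. qh \<le> i \<longrightarrow> i < qt \<longrightarrow> qh \<le> j \<longrightarrow> j < qt \<longrightarrow> root (q i) = root (q j)) \<and>
     (\<forall>i<qh. ls (q i) = []) \<and>
     (\<forall>v<n. \<forall>w k. (w, k) \<in> set (ls v) \<longrightarrow> w < n \<and> k \<in> label_class p \<and> ends k = {v, w}) \<and>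
     (\<forall>k\<in>label_class p. \<forall>v w. ends k = {v, w} \<longrightarrow>
       (w, k) \<in> set (ls v) \<or> num v \<noteq> 0 \<and> num w \<noteq> 0 \<and> root v = root w) \<and>
     (\<forall>v<r. num v \<noteq> 0)"

lemma search_invD:
  assumes "search_inv p num root par pe tr q qh qt r ls"
  shows "qh \<le> qt" "r \<le> n"
    "\<And>i. i < qt \<Longrightarrow> q i < n \<and> num (q i) = Suc i"
    "\<And>v. v < n \<Longrightarrow> num v \<noteq> 0 \<Longrightarrow> num v \<le> qt \<and> q (num v - 1) = v"
    "\<And>v. v < n \<Longrightarrow> num v \<noteq> 0 \<Longrightarrow> tree_inv p num root par pe tr v"
    "\<And>k. k \<in> label_class p \<Longrightarrow> tr k \<noteq> 0 \<Longrightarrow> \<exists>v<n. num v \<noteq> 0 \<and> root v \<noteq> v \<and> pe v = k"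
    "\<And>i j. qh \<le> i \<Longrightarrow> i < qt \<Longrightarrow> qh \<le> j \<Longrightarrow> j < qt \<Longrightarrow> root (q i) = root (q j)"
    "\<And>i. i < qh \<Longrightarrow> ls (q i) = []"
    "\<And>v w k. v < n \<Longrightarrow> (w, k) \<in> set (ls v) \<Longrightarrow> w < n \<and> k \<in> label_class p \<and> ends k = {v, w}"
    "\<And>k v w. k \<in> label_class p \<Longrightarrow> ends k = {v, w} \<Longrightarrow>
       (w, k) \<in> set (ls v) \<or> num v \<noteq> 0 \<and> num w \<noteq> 0 \<and> root v = root w"
    "\<And>v. v < r \<Longrightarrow> num v \<noteq> 0"
  using assms unfolding search_inv_def by (meson; fail)+

lemma search_invI:
  assumes "qh \<le> qt" "r \<le> n"
    "\<And>i. i < qt \<Longrightarrow> q i < n \<and> num (q i) = Suc i"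
    "\<And>v. v < n \<Longrightarrow> num v \<noteq> 0 \<Longrightarrow> num v \<le> qt \<and> q (num v - 1) = v"
    "\<And>v. v < n \<Longrightarrow> num v \<noteq> 0 \<Longrightarrow> tree_inv p num root par pe tr v"
    "\<And>k. k \<in> label_class p \<Longrightarrow> tr k \<noteq> 0 \<Longrightarrow> \<exists>v<n. num v \<noteq> 0 \<and> root v \<noteq> v \<and> pe v = k"
    "\<And>i j. qh \<le> i \<Longrightarrow> i < qt \<Longrightarrow> qh \<le> j \<Longrightarrow> j < qt \<Longrightarrow> root (q i) = root (q j)"
    "\<And>i. i < qh \<Longrightarrow> ls (q i) = []"
    "\<And>v w k. v < n \<Longrightarrow> (w, k) \<in> set (ls v) \<Longrightarrow> w < n \<and> k \<in> label_class p \<and> ends k = {v, w}"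
    "\<And>k v w. k \<in> label_class p \<Longrightarrow> ends k = {v, w} \<Longrightarrow>
       (w, k) \<in> set (ls v) \<or> num v \<noteq> 0 \<and> num w \<noteq> 0 \<and> root v = root w"
    "\<And>v. v < r \<Longrightarrow> num v \<noteq> 0"
  shows "search_inv p num root par pe tr q qh qt r ls"
  unfolding search_inv_def by (intro conjI; (intro allI ballI impI)?; rule assms; assumption)

text \<open>\<open>tree_inv\<close> reads the arrays only at discovered vertices, so the entries of
  a vertex that is just being discovered may be overwritten.\<close>

lemma tree_inv_mono:
  assumes "tree_inv p num root par pe tr v" "num v \<noteq> 0"
    and ext: "\<And>x. num x \<noteq> 0 \<Longrightarrow> num' x = num x \<and> root' x = root x \<and> par' x = par x \<and> pe' x = pe x"
    and "\<And>k. tr k \<noteq> 0 \<Longrightarrow> tr' k \<noteq> 0"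
  shows "tree_inv p num' root' par' pe' tr' v"
  using assms(1,2,4) ext[of v] ext[of "root v"] ext[of "par v"] by (simp add: tree_inv_def)

lemma search_inv_init:
  assumes "\<And>v. v < n \<Longrightarrow> num v = 0" "\<And>k. k < m \<Longrightarrow> tr k = 0"
  shows "search_inv p num root par pe tr q 0 0 0 (adj p m)"
proof (rule search_invI)
  show "w < n \<and> k \<in> label_class p \<and> ends k = {v, w}" if "(w, k) \<in> set (adj p m v)" for v w k
    using adj_sound[OF that] ends_subset[of k] by (auto dest: label_classD)
  show "(w, k) \<in> set (adj p m v) \<or> num v \<noteq> 0 \<and> num w \<noteq> 0 \<and> root v = root w"
    if "k \<in> label_class p" "ends k = {v, w}" for v w k
    using adj_complete[of k m p] that by (simp add: label_class_def)
qed (use assms in \<open>auto dest: label_classD\<close>)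

lemma search_inv_pop:
  assumes inv: "search_inv p num root par pe tr q qh qt r ls" and "qh < qt" "ls (q qh) = []"
  shows "search_inv p num root par pe tr q (Suc qh) qt r ls"
proof (rule search_invI)
  show "ls (q i) = []" if "i < Suc qh" for i
    using that assms(3) search_invD(8)[OF inv] by (auto simp: less_Suc_eq)
  show "root (q i) = root (q j)" if "Suc qh \<le> i" "i < qt" "Suc qh \<le> j" "j < qt" for i j
    using that search_invD(7)[OF inv] by simp
qed (rule Suc_leI[OF assms(2)], (rule search_invD[OF inv]; assumption)+)

lemma search_inv_skip:
  assumes inv: "search_inv p num root par pe tr q qh qt r ls" and "r < n" "num r \<noteq> 0"
  shows "search_inv p num root par pe tr q qh qt (Suc r) ls"
proof (rule search_invI)
  show "num v \<noteq> 0" if "v < Suc r" for v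
    using that assms(3) search_invD(11)[OF inv] by (auto simp: less_Suc_eq)
qed (rule Suc_leI[OF assms(2)] search_invD[OF inv]; assumption)+

lemma search_inv_root:
  assumes inv: "search_inv p num root par pe tr q qh qt r ls" and "\<not> qh < qt" "r < n" "num r = 0"
  shows "search_inv p (num(r := Suc qt)) (root(r := r)) par pe tr (q(qt := r)) qh (Suc qt) (Suc r) ls"
proof (rule search_invI)
  note I = search_invD[OF inv]
  let ?num = "num(r := Suc qt)" and ?root = "root(r := r)" and ?q = "q(qt := r)"
  have q_r: "q i \<noteq> r" if "i < qt" for i using I(3)[OF that] assms(4) by auto
  show "qh \<le> Suc qt" "Suc r \<le> n" using I(1) assms(3) by auto
  show "?q i < n \<and> ?num (?q i) = Suc i" if "i < Suc qt" for i
    using that I(3) assms(3) q_r by (auto simp: less_Suc_eq)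
  show "?num v \<le> Suc qt \<and> ?q (?num v - 1) = v" if "v < n" "?num v \<noteq> 0" for v
    using that I(4)[of v] by (cases "v = r") auto
  show "tree_inv p ?num ?root par pe tr v" if "v < n" "?num v \<noteq> 0" for v
  proof (cases "v = r")
    case True
    with assms(3) show ?thesis by (simp add: tree_inv_def)
  next
    case False
    with that I(5)[of v] assms(4) show ?thesis by (auto elim!: tree_inv_mono)
  qed
  show "\<exists>v<n. ?num v \<noteq> 0 \<and> ?root v \<noteq> v \<and> pe v = k" if "k \<in> label_class p" "tr k \<noteq> 0" for k
  proof -
    from I(6)[OF that] obtain v where "v < n" "num v \<noteq> 0" "root v \<noteq> v" "pe v = k" by blast
    then show ?thesis using assms(4) by (intro exI[of _ v]) auto
  qed
  show "?root (?q i) = ?root (?q j)" if "qh \<le> i" "i < Suc qt" "qh \<le> j" "j < Suc qt" for i j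
    using that assms(2) I(1) by (auto simp: less_Suc_eq)
  show "ls (?q i) = []" if "i < qh" for i using that I(1,8) by auto
  show "(w, k) \<in> set (ls v) \<or> ?num v \<noteq> 0 \<and> ?num w \<noteq> 0 \<and> ?root v = ?root w"
    if "k \<in> label_class p" "ends k = {v, w}" for k v w
    using I(10)[OF that] assms(4) by auto
  show "?num v \<noteq> 0" if "v < Suc r" for v using that I(11) by (auto simp: less_Suc_eq)
qed (use search_invD(9)[OF inv] in simp)

text \<open>It must be shown that \<open>w\<close> has the same root as the scanned vertex. If
  \<open>w\<close> is finished, its list is empty, and the edge has already been certified from the
  side of \<open>w\<close>. Otherwise \<open>w\<close> is still queued, and all queued vertices have
  the same root.\<close>

lemma search_inv_scan:
  assumes inv: "search_inv p num root par pe tr q qh qt r ls"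
    and "qh < qt" "ls (q qh) = (w, k) # xs" and old: "num w \<noteq> 0"
  shows "search_inv p num root par pe tr q qh qt r (ls(q qh := xs))"
proof (rule search_invI)
  note I = search_invD[OF inv]
  let ?u = "q qh" and ?ls = "ls(q qh := xs)"
  have u: "?u < n" "num ?u = Suc qh" using I(3)[OF assms(2)] by auto
  have k: "w < n" "k \<in> label_class p" "ends k = {?u, w}" using I(9)[OF u(1), of w k] assms(3) by auto
  have root: "root ?u = root w"
  proof (cases "num w - 1 < qh")
    case True
    then have "ls w = []" using I(4)[OF k(1) old] I(8) by metis
    moreover have "ends k = {w, ?u}" using k(3) by auto
    ultimately show ?thesis using I(10)[OF k(2), of w ?u] by auto
  next
    case False
    moreover have "num w - 1 < qt" using I(4)[OF k(1) old] old by linarith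
    ultimately show ?thesis using I(7)[of qh "num w - 1"] I(4)[OF k(1) old] assms(2) by simp
  qed
  show "?ls (q i) = []" if "i < qh" for i
  proof -
    have "num (q i) = Suc i" using I(3)[of i] that assms(2) by simp
    then have "q i \<noteq> ?u" using u(2) that by auto
    then show ?thesis using I(8)[OF that] by simp
  qed
  show "w' < n \<and> k' \<in> label_class p \<and> ends k' = {v, w'}" if "v < n" "(w', k') \<in> set (?ls v)" for v w' k'
    using I(9)[OF that(1), of w' k'] that(2) assms(3) by (auto split: if_splits)
  show "(w', k') \<in> set (?ls v) \<or> num v \<noteq> 0 \<and> num w' \<noteq> 0 \<and> root v = root w'"
    if "k' \<in> label_class p" "ends k' = {v, w'}" for k' v w'
    using I(10)[OF that] assms(3) root u(2) old by auto
qed (rule search_invD[OF inv]; assumption)+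

text \<open>\<open>w\<close> inherits the common root of the queue, and its number
  \<open>Suc qt\<close> exceeds all earlier ones, in particular those of its parent and its
  root.\<close>

lemma search_inv_discover:
  assumes inv: "search_inv p num root par pe tr q qh qt r ls"
    and "qh < qt" "ls (q qh) = (w, k) # xs" and new: "num w = 0"
  shows "search_inv p (num(w := Suc qt)) (root(w := root (q qh))) (par(w := q qh)) (pe(w := k))
    (tr(k := 1)) (q(qt := w)) qh (Suc qt) r (ls(q qh := xs))"
proof (rule search_invI)
  note I = search_invD[OF inv]
  let ?u = "q qh" and ?ls = "ls(q qh := xs)"
  let ?num = "num(w := Suc qt)" and ?root = "root(w := root ?u)" and ?par = "par(w := ?u)"
    and ?pe = "pe(w := k)" and ?tr = "tr(k := 1)" and ?q = "q(qt := w)"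
  have u: "?u < n" "num ?u = Suc qh" using I(3)[OF assms(2)] by auto
  have k: "w < n" "k \<in> label_class p" "ends k = {?u, w}" using I(9)[OF u(1), of w k] assms(3) by auto
  have uw: "?u \<noteq> w" using u(2) new by auto
  have tree_u: "tree_inv p num root par pe tr ?u" using I(5) u by simp
  have q_w: "q i \<noteq> w" if "i < qt" for i using I(3)[OF that] new by auto
  show "qh \<le> Suc qt" "r \<le> n" using I(1,2) by auto
  show "?q i < n \<and> ?num (?q i) = Suc i" if "i < Suc qt" for i
    using that I(3) k(1) q_w by (auto simp: less_Suc_eq)
  show "?num v \<le> Suc qt \<and> ?q (?num v - 1) = v" if "v < n" "?num v \<noteq> 0" for v
    using that I(4)[of v] by (cases "v = w") auto
  show "tree_inv p ?num ?root ?par ?pe ?tr v" if v: "v < n" "?num v \<noteq> 0" for v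
  proof (cases "v = w")
    case True
    have "root ?u \<noteq> w" "num (root ?u) \<le> Suc qt"
      using tree_u new u(2) assms(2) by (auto simp: tree_inv_def)
    then show ?thesis
      using True tree_u u assms(2) k uw by (simp add: tree_inv_def insert_commute)
  next
    case False
    with v I(5)[of v] new show ?thesis by (auto elim!: tree_inv_mono)
  qed
  show "\<exists>v<n. ?num v \<noteq> 0 \<and> ?root v \<noteq> v \<and> ?pe v = k'"
    if "k' \<in> label_class p" "?tr k' \<noteq> 0" for k'
  proof (cases "k' = k")
    case True
    have "root ?u \<noteq> w" using tree_u new by (auto simp: tree_inv_def)
    with True k(1) show ?thesis by (intro exI[of _ w]) auto
  next
    case False
    with that I(6)[of k'] obtain v where "v < n" "num v \<noteq> 0" "root v \<noteq> v" "pe v = k'" by auto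
    then show ?thesis using new by (intro exI[of _ v]) auto
  qed
  have rt: "?root (?q i) = root ?u" if "qh \<le> i" "i < Suc qt" for i
    using that I(7)[of i qh] assms(2) q_w by (auto simp: less_Suc_eq)
  show "?root (?q i) = ?root (?q j)" if "qh \<le> i" "i < Suc qt" "qh \<le> j" "j < Suc qt" for i j
    using rt that by simp
  show "?ls (?q i) = []" if "i < qh" for i
  proof -
    have "num (q i) = Suc i" using I(3)[of i] that assms(2) by simp
    then have "q i \<noteq> ?u" using u(2) that by auto
    then show ?thesis using I(8)[OF that] that assms(2) by simp
  qed
  show "w' < n \<and> k' \<in> label_class p \<and> ends k' = {v, w'}" if "v < n" "(w', k') \<in> set (?ls v)" for v w' k'
    using I(9)[OF that(1), of w' k'] that(2) assms(3) by (auto split: if_splits)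
  show "(w', k') \<in> set (?ls v) \<or> ?num v \<noteq> 0 \<and> ?num w' \<noteq> 0 \<and> ?root v = ?root w'"
    if "k' \<in> label_class p" "ends k' = {v, w'}" for k' v w'
    using I(10)[OF that] assms(3) u(2) uw new by auto
  show "?num v \<noteq> 0" if "v < r" for v using I(11)[OF that] new by auto
qed

text \<open>\<open>r\<close> has passed all vertices, so all are discovered; the queue is empty, so
  all are finished and their lists are exhausted.\<close>

lemma search_inv_final:
  assumes inv: "search_inv p num root par pe tr q qh qt r ls" and "\<not> qh < qt" "\<not> r < n"
  shows "spanning p num root par pe tr"
proof -
  note I = search_invD[OF inv]
  have disc: "num v \<noteq> 0" if "v < n" for v
    using I(11)[of v] that assms(3) by simp
  have q: "num v \<le> qh" "q (num v - 1) = v" if "v < n" for v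
    using I(1) I(4)[OF that disc[OF that]] assms(2) by auto
  have ls: "ls v = []" if "v < n" for v
    using I(8)[of "num v - 1"] q[OF that] disc[OF that] by (cases "num v") auto
  have "inj_on num {..<n}" using q(2) by (metis inj_onI lessThan_iff)
  moreover have "root (src k) = root (tgt k)" if "k \<in> label_class p" for k
    using I(10)[OF that, of "src k" "tgt k"] ls[of "src k"] src_less[of k] label_classD[OF that]
    by (simp add: ends_def)
  moreover have "\<exists>v<n. root v \<noteq> v \<and> pe v = k" if "k \<in> label_class p" "tr k \<noteq> 0" for k
    using I(6)[OF that] by blast
  moreover have "tree_inv p num root par pe tr v" if "v < n" for v
    using I(5)[OF that disc[OF that]] .
  ultimately show ?thesis by (simp add: spanning_def tree_inv_def)
qed

end

text \<open>Half-edges are numbered from 1, so that 0 can mark the end of a list.\<close>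

primrec chain :: "(nat \<Rightarrow> nat) \<Rightarrow> (nat \<Rightarrow> nat) \<Rightarrow> (nat \<Rightarrow> nat) \<Rightarrow> nat \<Rightarrow> nat \<Rightarrow> (nat \<times> nat) list \<Rightarrow> bool" where
  "chain tgt ed nx B h [] \<longleftrightarrow> h = 0"
| "chain tgt ed nx B h (x # xs) \<longleftrightarrow>
     0 < h \<and> h \<le> B \<and> tgt h = fst x \<and> ed h = snd x \<and> chain tgt ed nx B (nx h) xs"

text \<open>The lists occupy cells up to \<open>B\<close> only, so writing the next cell changes
  none of them.\<close>

lemma chain_fresh:
  "chain tgt ed nx B h xs \<Longrightarrow>
    chain (tgt(Suc B := a)) (ed(Suc B := b)) (nx(Suc B := c)) (Suc B) h xs"
  by (induction xs arbitrary: h) auto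

section \<open>The search as a machine program\<close>

abbreviation Inc_Var :: "string \<Rightarrow> com" where
  "Inc_Var x \<equiv> Assign x (Inc (Var x))"

fun Seqs :: "com list \<Rightarrow> com" where
  "Seqs [] = Skip"
| "Seqs [c] = c"
| "Seqs (c # cs) = Seq c (Seqs cs)"

text \<open>The arrays are shared by both parts. Besides \<open>head\<close> and \<open>num\<close>,
  only \<open>tr\<close> is reset (in \<open>build_body\<close>); old values of \<open>root\<close>,
  \<open>par\<close> and \<open>pe\<close> do no harm, since they are read at discovered vertices
  only.\<close>

definition clear_body :: com where
  "clear_body = Seqs [
     Store ''head'' (Var ''i'') (Const 0),
     Store ''num'' (Var ''i'') (Const 0),
     Inc_Var ''i'']"

definition add_half_edge :: "string \<Rightarrow> string \<Rightarrow> com" where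
  "add_half_edge x y = Seqs [
     Inc_Var ''h'',
     Store ''to'' (Var ''h'') (Get y (Var ''i'')),
     Store ''ed'' (Var ''h'') (Var ''i''),
     Store ''nx'' (Var ''h'') (Get ''head'' (Get x (Var ''i''))),
     Store ''head'' (Get x (Var ''i'')) (Var ''h'')]"

definition build_body :: "nat \<Rightarrow> com" where
  "build_body p = Seqs [
     Store ''tr'' (Var ''i'') (Const 0),
     Cond (Eq (Get ''part'' (Var ''i'')) (Const p))
       (Seq (add_half_edge ''src'' ''tgt'') (add_half_edge ''tgt'' ''src''))
       Skip,
     Inc_Var ''i'']"

definition enqueue :: "string \<Rightarrow> com" where
  "enqueue x = Seqs [
     Store ''q'' (Var ''qt'') (Var x),
     Inc_Var ''qt'',
     Store ''num'' (Var x) (Var ''qt'')]"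

text \<open>One flat loop instead of nested ones: an iteration scans one list entry, drops one
  finished vertex from the queue or advances \<open>r\<close>. A single potential can then bound the
  total time.\<close>

definition search_body :: com where
  "search_body =
     Cond (Less (Var ''qh'') (Var ''qt''))
       (Seqs [
         Assign ''u'' (Get ''q'' (Var ''qh'')),
         Assign ''j'' (Get ''head'' (Var ''u'')),
         Cond (Eq (Var ''j'') (Const 0))
           (Inc_Var ''qh'')
           (Seqs [
             Store ''head'' (Var ''u'') (Get ''nx'' (Var ''j'')),
             Assign ''w'' (Get ''to'' (Var ''j'')),
             Cond (Eq (Get ''num'' (Var ''w'')) (Const 0))
               (Seqs [
                 enqueue ''w'',
                 Store ''root'' (Var ''w'') (Get ''root'' (Var ''u'')),
                 Store ''par'' (Var ''w'') (Var ''u''),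
                 Store ''pe'' (Var ''w'') (Get ''ed'' (Var ''j'')),
                 Store ''tr'' (Get ''ed'' (Var ''j'')) (Const 1)])
               Skip])])
       (Seqs [
         Cond (Eq (Get ''num'' (Var ''r'')) (Const 0))
           (Seq (enqueue ''r'') (Store ''root'' (Var ''r'') (Var ''r'')))
           Skip,
         Inc_Var ''r''])"

text \<open>The last loop test is the disjunction of \<open>qh < qt\<close> and
  \<open>r < n\<close>, written with \<open>Neg\<close> and \<open>Conj\<close>.\<close>

definition spanning_forest :: "nat \<Rightarrow> com" where
  "spanning_forest p = Seqs [
     Assign ''i'' (Const 0),
     While (Less (Var ''i'') (Var ''n'')) clear_body,
     Assign ''i'' (Const 0),
     Assign ''h'' (Const 0),
     While (Less (Var ''i'') (Var ''m'')) (build_body p),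
     Assign ''qh'' (Const 0),
     Assign ''qt'' (Const 0),
     Assign ''r'' (Const 0),
     While (Neg (Conj (Neg (Less (Var ''qh'') (Var ''qt''))) (Neg (Less (Var ''r'') (Var ''n'')))))
       search_body]"

context indexed_graph
begin

text \<open>The input together with the arrays \<open>out\<close> and \<open>mate\<close>, which the
  search must leave alone.\<close>

definition frame :: "(nat \<Rightarrow> nat) \<Rightarrow> (nat \<Rightarrow> nat) \<Rightarrow> memory \<Rightarrow> bool" where
  "frame out mate s \<longleftrightarrow> s ''n'' 0 = n \<and> s ''m'' 0 = m \<and> s ''src'' = src \<and> s ''tgt'' = tgt \<and>
     s ''part'' = part \<and> s ''out'' = out \<and> s ''mate'' = mate"

lemma wp_clear:
  assumes "frame out mate s" "s ''i'' 0 = 0"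
  shows "wp (While (Less (Var ''i'') (Var ''n'')) clear_body) (\<lambda>t s'. t \<le> 4 * n + 1 \<and>
    frame out mate s' \<and> (\<forall>v<n. s' ''head'' v = 0 \<and> s' ''num'' v = 0)) s"
proof -
  define I where
    "I i s \<longleftrightarrow> frame out mate s \<and> (\<forall>v<i. s ''head'' v = 0 \<and> s ''num'' v = 0)" for i s
  have "wp (While (Less (Var ''i'') (Var ''n'')) clear_body) (\<lambda>t s'. t \<le> (3 + 1) * n + 1 \<and> I n s') s"
  proof (rule wp_count)
    fix i s assume "i < n" "s ''i'' 0 = i" "I i s"
    then show "wp clear_body (\<lambda>t s'. t \<le> 3 \<and> s' ''i'' 0 = Suc i \<and> I (Suc i) s') s"
      by (simp add: clear_body_def I_def frame_def less_Suc_eq)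
  qed (use assms in \<open>simp_all add: I_def frame_def\<close>)
  then show ?thesis by (simp add: I_def)
qed

definition adjacency :: "memory \<Rightarrow> (nat \<Rightarrow> (nat \<times> nat) list) \<Rightarrow> bool" where
  "adjacency s ls \<longleftrightarrow> (\<forall>v<n. chain (s ''to'') (s ''ed'') (s ''nx'') (s ''h'' 0) (s ''head'' v) (ls v))"

lemma wp_build:
  assumes "frame out mate s" "s ''i'' 0 = 0" "s ''h'' 0 = 0"
    "\<forall>v<n. s ''head'' v = 0 \<and> s ''num'' v = 0"
  shows "wp (While (Less (Var ''i'') (Var ''m'')) (build_body p)) (\<lambda>t s'. t \<le> 14 * m + 1 \<and>
    frame out mate s' \<and> (\<forall>v<n. s' ''num'' v = 0) \<and> (\<forall>k<m. s' ''tr'' k = 0) \<and>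
    adjacency s' (adj p m)) s"
proof -
  define I where
    "I i s \<longleftrightarrow> frame out mate s \<and> (\<forall>v<n. s ''num'' v = 0) \<and> (\<forall>k<i. s ''tr'' k = 0) \<and>
      adjacency s (adj p i)" for i s
  \<comment> \<open>An iteration takes at most 13 steps: five for each half-edge and one each for
    resetting \<open>tr\<close>, the test of the part and the increment.\<close>
  have "wp (While (Less (Var ''i'') (Var ''m'')) (build_body p))
    (\<lambda>t s'. t \<le> (13 + 1) * m + 1 \<and> I m s') s"
  proof (rule wp_count)
    fix i s assume i: "i < m" "s ''i'' 0 = i" "I i s"
    note e = src_less[OF i(1)] tgt_less[OF i(1)] no_loop[OF i(1)]
    show "wp (build_body p) (\<lambda>t s'. t \<le> 13 \<and> s' ''i'' 0 = Suc i \<and> I (Suc i) s') s"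
      using i e
      by (simp add: build_body_def add_half_edge_def I_def frame_def adjacency_def less_Suc_eq)
        (auto intro!: chain_fresh)
  qed (use assms in \<open>simp_all add: I_def frame_def adjacency_def\<close>)
  then show ?thesis by (simp add: I_def)
qed

definition search_state :: "nat \<Rightarrow> memory \<Rightarrow> (nat \<Rightarrow> (nat \<times> nat) list) \<Rightarrow> bool" where
  "search_state p s ls \<longleftrightarrow>
     search_inv p (s ''num'') (s ''root'') (s ''par'') (s ''pe'') (s ''tr'') (s ''q'')
       (s ''qh'' 0) (s ''qt'' 0) (s ''r'' 0) ls \<and> adjacency s ls"

text \<open>A potential that drops in every iteration. A discovery lengthens the queue by one, but
  uses up a list entry and an undiscovered vertex; a new root uses up an undiscovered vertex and a
  value of \<open>r\<close>. The factor 20 exceeds the 14 steps of the longest branch of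
  \<open>search_body\<close>.\<close>

definition search_budget :: "memory \<Rightarrow> (nat \<Rightarrow> (nat \<times> nat) list) \<Rightarrow> nat" where
  "search_budget s ls = 20 * ((\<Sum>v<n. length (ls v)) + card {v. v < n \<and> s ''num'' v = 0} +
     (n - s ''r'' 0) + (s ''qt'' 0 - s ''qh'' 0))"

lemma sum_length_pop:
  fixes ls :: "nat \<Rightarrow> 'b list"
  assumes "u < n" "ls u = x # xs"
  shows "(\<Sum>v<n. length (ls v)) = Suc (\<Sum>v<n. length ((ls(u := xs)) v))"
proof -
  have "(\<Sum>v<n. length (ls v)) = length (ls u) + (\<Sum>v\<in>{..<n} - {u}. length (ls v))"
    using assms by (simp add: sum.remove)
  moreover have "(\<Sum>v<n. length ((ls(u := xs)) v)) =
      length xs + (\<Sum>v\<in>{..<n} - {u}. length ((ls(u := xs)) v))"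
    using assms sum.remove[of "{..<n}" u "\<lambda>v. length ((ls(u := xs)) v)"] by simp
  moreover have "(\<Sum>v\<in>{..<n} - {u}. length ((ls(u := xs)) v)) =
      (\<Sum>v\<in>{..<n} - {u}. length (ls v))"
    by (intro sum.cong) auto
  ultimately show ?thesis using assms by simp
qed

lemma card_undiscovered:
  fixes num :: "nat \<Rightarrow> nat"
  assumes "w < n" "num w = 0"
  shows "card {v. v < n \<and> num v = 0} = Suc (card {v. v < n \<and> (num(w := Suc i)) v = 0})"
proof -
  have "{v. v < n \<and> num v = 0} = insert w {v. v < n \<and> (num(w := Suc i)) v = 0}"
    using assms by auto
  then show ?thesis by simp
qed

lemma wp_search_body:
  assumes F: "frame out mate s" and S: "search_state p s ls"
    and run: "s ''qh'' 0 < s ''qt'' 0 \<or> s ''r'' 0 < n"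
  shows "wp search_body (\<lambda>t s'. \<exists>ls'. frame out mate s' \<and> search_state p s' ls' \<and>
    search_budget s' ls' + t < search_budget s ls) s"
proof (cases "s ''qh'' 0 < s ''qt'' 0")
  case False
  with run have r: "s ''r'' 0 < n" by simp
  from S have inv: "search_inv p (s ''num'') (s ''root'') (s ''par'') (s ''pe'') (s ''tr'') (s ''q'')
       (s ''qh'' 0) (s ''qt'' 0) (s ''r'' 0) ls" and A: "adjacency s ls"
    by (auto simp: search_state_def)
  show ?thesis
  proof (cases "s ''num'' (s ''r'' 0) = 0")
    case True
    note inv' = search_inv_root[OF inv False r True]
    note card = card_undiscovered[of "s ''r'' 0" "s ''num''" "s ''qt'' 0", OF r True]
    show ?thesis
      using False True F A inv' card r
      by (simp add: search_body_def enqueue_def search_state_def search_budget_def frame_def adjacency_def)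
        (intro exI[of _ ls]; auto)
  next
    case num: False
    note inv' = search_inv_skip[OF inv r num]
    show ?thesis
      using False num F A inv' r
      by (simp add: search_body_def enqueue_def search_state_def search_budget_def frame_def adjacency_def)
        (intro exI[of _ ls]; auto)
  qed
next
  case True
  from S have inv: "search_inv p (s ''num'') (s ''root'') (s ''par'') (s ''pe'') (s ''tr'') (s ''q'')
       (s ''qh'' 0) (s ''qt'' 0) (s ''r'' 0) ls" and A: "adjacency s ls"
    by (auto simp: search_state_def)
  define u where "u = s ''q'' (s ''qh'' 0)"
  have u: "u < n" using search_invD(3)[OF inv True] by (simp add: u_def)
  then have ch: "chain (s ''to'') (s ''ed'') (s ''nx'') (s ''h'' 0) (s ''head'' u) (ls u)"
    using A by (simp add: adjacency_def)
  show ?thesis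
  proof (cases "ls u")
    case Nil
    note inv' = search_inv_pop[OF inv True Nil[unfolded u_def]]
    have "s ''head'' u = 0" using ch Nil by simp
    then show ?thesis
      using True F A inv'
      by (simp add: search_body_def search_state_def search_budget_def frame_def adjacency_def u_def)
        (intro exI[of _ ls]; auto)
  next
    case (Cons x xs)
    obtain w k where x: "x = (w, k)" by (cases x)
    let ?j = "s ''head'' u"
    from ch Cons x have j: "0 < ?j" "s ''to'' ?j = w" "s ''ed'' ?j = k"
      "chain (s ''to'') (s ''ed'') (s ''nx'') (s ''h'' 0) (s ''nx'' ?j) xs"
      by auto
    have wn: "w < n" using search_invD(9)[OF inv u, of w k] Cons x by simp
    note sum = sum_length_pop[of u ls x xs, OF u Cons]
    show ?thesis
    proof (cases "s ''num'' w = 0")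
      case new: True
      note inv' = search_inv_discover[OF inv True Cons[unfolded x u_def] new, folded u_def]
      note card = card_undiscovered[of w "s ''num''" "s ''qt'' 0", OF wn new]
      show ?thesis
        using True F A inv' card j new sum
        by (simp add: search_body_def enqueue_def search_state_def search_budget_def frame_def
            adjacency_def u_def[symmetric])
          (intro exI[of _ "ls(u := xs)"]; auto)
    next
      case old: False
      note inv' = search_inv_scan[OF inv True Cons[unfolded x u_def] old, folded u_def]
      show ?thesis
        using True F A inv' j old sum
        by (simp add: search_body_def search_state_def search_budget_def frame_def
            adjacency_def u_def[symmetric])
          (intro exI[of _ "ls(u := xs)"]; auto)
    qed
  qed
qed

lemma wp_search:
  assumes F: "frame out mate s" and "s ''qh'' 0 = 0" "s ''qt'' 0 = 0" "s ''r'' 0 = 0"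
    "\<forall>v<n. s ''num'' v = 0" "\<forall>k<m. s ''tr'' k = 0" "adjacency s (adj p m)"
  shows "wp (While (Neg (Conj (Neg (Less (Var ''qh'') (Var ''qt''))) (Neg (Less (Var ''r'') (Var ''n'')))))
       search_body)
    (\<lambda>t s'. t \<le> 40 * (n + m) + 1 \<and> frame out mate s' \<and>
      spanning p (s' ''num'') (s' ''root'') (s' ''par'') (s' ''pe'') (s' ''tr'')) s"
    (is "wp (While ?b _) _ _")
proof -
  define I where
    "I T s \<longleftrightarrow> (\<exists>ls. frame out mate s \<and> search_state p s ls \<and> T = search_budget s ls)" for T s
  have "wp (While ?b search_body)
    (\<lambda>t s'. t \<le> search_budget s (adj p m) + 1 \<and> \<not> bval ?b s' \<and> (\<exists>T'. I T' s')) s"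
  proof (rule wp_While)
    fix T s assume "I T s" and b: "bval ?b s"
    then obtain ls where ls: "frame out mate s" "search_state p s ls" "T = search_budget s ls"
      by (auto simp: I_def)
    from b have "s ''qh'' 0 < s ''qt'' 0 \<or> s ''r'' 0 < n"
      using ls(1) by (auto simp: frame_def)
    then show "wp search_body (\<lambda>t s'. \<exists>T'. I T' s' \<and> T' + t < T) s"
      by (rule wp_mono[OF wp_search_body[OF ls(1,2)]]) (auto simp: I_def ls(3))
  next
    show "I (search_budget s (adj p m)) s"
      using assms search_inv_init[of "s ''num''" "s ''tr''"] unfolding I_def search_state_def
      by (intro exI[of _ "adj p m"]) simp
  qed
  \<comment> \<open>Initially there are at most \<open>2 * m\<close> list entries, \<open>n\<close>
    undiscovered vertices, \<open>n\<close> values of \<open>r\<close> and an empty queue.\<close>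
  moreover have "search_budget s (adj p m) \<le> 40 * (n + m)"
  proof -
    have "card {v. v < n \<and> s ''num'' v = 0} \<le> n"
      using card_mono[of "{..<n}" "{v. v < n \<and> s ''num'' v = 0}"] by auto
    then show ?thesis using adj_length[of m p] assms(2-4) by (simp add: search_budget_def)
  qed
  ultimately show ?thesis
  proof (elim wp_mono, elim conjE exE, intro conjI)
    fix t s' T'
    assume "\<not> bval ?b s'" "I T' s'"
    then obtain ls where ls: "frame out mate s'" "search_state p s' ls"
      and b: "\<not> s' ''qh'' 0 < s' ''qt'' 0" "\<not> s' ''r'' 0 < s' ''n'' 0"
      by (auto simp: I_def)
    show "frame out mate s'" by fact
    have "\<not> s' ''r'' 0 < n" using b(2) ls(1) by (simp add: frame_def)
    with b(1) ls(2) show "spanning p (s' ''num'') (s' ''root'') (s' ''par'') (s' ''pe'') (s' ''tr'')"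
      unfolding search_state_def by (blast intro: search_inv_final)
  qed simp
qed

text \<open>The factor 54 is 14 for building the lists plus 40 for the search; clearing costs 4 per
  vertex.\<close>

lemma wp_spanning_forest:
  assumes "frame out mate s"
  shows "wp (spanning_forest p) (\<lambda>t s'. t \<le> 54 * (n + m) + 20 \<and> frame out mate s' \<and>
      spanning p (s' ''num'') (s' ''root'') (s' ''par'') (s' ''pe'') (s' ''tr'')) s"
  unfolding spanning_forest_def Seqs.simps wp_Seq wp_Store
proof (rule wp_mono[OF wp_clear[of out mate]], goal_cases)
  case clear: (3 t s)
  show ?case
  proof (rule wp_mono[OF wp_build[of out mate]], goal_cases)
    case build: (5 t' s')
    show ?case
    proof (rule wp_mono[OF wp_search[of out mate _ p]], goal_cases)
      case (8 t'' s'')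
      with clear build show ?case by simp
    qed (use build in \<open>auto simp: frame_def adjacency_def\<close>)
  qed (use clear in \<open>auto simp: frame_def\<close>)
qed (use assms in \<open>auto simp: frame_def\<close>)

end

section \<open>Selection of the linear forest\<close>

text \<open>Overwriting \<open>w\<close> by the parent lets both choices share the rest of the code.
  Both mates are read before either is stored, since on a path with one vertex \<open>u\<close> or
  \<open>w\<close> is its own mate.\<close>

definition select_body :: "nat \<Rightarrow> com" where
  "select_body p = Seqs [
     Cond (Conj (Eq (Get ''part'' (Var ''i'')) (Const p)) (Eq (Get ''tr'' (Var ''i'')) (Const 0)))
       (Seqs [
         Cond (Less (Get ''num'' (Get ''src'' (Var ''i''))) (Get ''num'' (Get ''tgt'' (Var ''i''))))
           (Seq (Assign ''u'' (Get ''tgt'' (Var ''i''))) (Assign ''w'' (Get ''src'' (Var ''i''))))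
           (Seq (Assign ''u'' (Get ''src'' (Var ''i''))) (Assign ''w'' (Get ''tgt'' (Var ''i'')))),
         Assign ''e'' (Var ''i''),
         Cond (Eq (Get ''mate'' (Var ''u'')) (Var ''w''))
           (Seq (Assign ''w'' (Get ''par'' (Var ''u''))) (Assign ''e'' (Get ''pe'' (Var ''u''))))
           Skip,
         Store ''out'' (Var ''e'') (Const 3),
         Assign ''a'' (Get ''mate'' (Var ''u'')),
         Assign ''b'' (Get ''mate'' (Var ''w'')),
         Store ''mate'' (Var ''a'') (Var ''b''),
         Store ''mate'' (Var ''b'') (Var ''a'')])
       Skip,
     Inc_Var ''i'']"

definition phase :: "nat \<Rightarrow> com" where
  "phase p = Seqs [
     spanning_forest p,
     Assign ''i'' (Const 0),
     While (Less (Var ''i'') (Var ''m'')) (select_body p)]"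

section \<open>Invariant of the selection\<close>

context labelled_graph
begin

definition chosen :: "(nat \<Rightarrow> nat) \<Rightarrow> nat set" where
  "chosen out = {k. k < m \<and> out k = 3}"

lemma chosen_upd: "k < m \<Longrightarrow> chosen (out(k := 3)) = insert k (chosen out)"
  by (auto simp: chosen_def)

definition valid_choice :: "(nat \<Rightarrow> nat) \<Rightarrow> (nat \<Rightarrow> nat) \<Rightarrow> bool" where
  "valid_choice out mate \<longleftrightarrow>
     (\<forall>k<m. out k = part k \<or> out k = 3) \<and>
     (\<forall>k\<in>chosen out. \<forall>l\<in>chosen out. k \<noteq> l \<longrightarrow> part k = part l \<longrightarrow> ends k \<inter> ends l = {}) \<and>
     mated_paths {..<n} (ends ` chosen out) mate"

definition hits :: "(nat \<Rightarrow> nat) \<Rightarrow> nat \<Rightarrow> bool" where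
  "hits out p \<longleftrightarrow> (\<forall>C\<in>cycles (edge ` label_class p). \<exists>k\<in>chosen out. edge k \<in> C)"

lemma hits_upd: "k < m \<Longrightarrow> hits out p \<Longrightarrow> hits (out(k := 3)) p"
  by (auto simp: hits_def chosen_upd)

text \<open>\<open>S\<close> is the set of parts already processed.\<close>

definition partial_choice :: "nat set \<Rightarrow> (nat \<Rightarrow> nat) \<Rightarrow> (nat \<Rightarrow> nat) \<Rightarrow> bool" where
  "partial_choice S out mate \<longleftrightarrow>
     valid_choice out mate \<and> (\<forall>k\<in>chosen out. part k \<in> S) \<and> (\<forall>q\<in>S. hits out q)"

text \<open>Every edge taken from \<open>p\<close> is traced to the triple of an edge
  \<open>j\<close> already treated. By \<open>triple_disjoint\<close> it misses the triples still to
  come.\<close>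

definition select_inv :: "nat \<Rightarrow> nat set \<Rightarrow> (nat \<Rightarrow> nat) \<Rightarrow> (nat \<Rightarrow> nat) \<Rightarrow> (nat \<Rightarrow> nat) \<Rightarrow> nat \<Rightarrow>
    (nat \<Rightarrow> nat) \<Rightarrow> (nat \<Rightarrow> nat) \<Rightarrow> bool" where
  "select_inv p S num pe tr i out mate \<longleftrightarrow>
     valid_choice out mate \<and> (\<forall>q\<in>S. hits out q) \<and>
     (\<forall>k\<in>chosen out. part k \<in> S \<or>
       part k = p \<and> (\<exists>j<i. j \<in> nontree p tr \<and> ends k \<subseteq> triple num pe j)) \<and>
     (\<forall>j<i. j \<in> nontree p tr \<longrightarrow> out j = 3 \<or> out (pe (top_end num j)) = 3)"

lemma select_inv_skip:
  "select_inv p S num pe tr i out mate \<Longrightarrow> i \<notin> nontree p tr \<Longrightarrow>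
    select_inv p S num pe tr (Suc i) out mate"
  unfolding select_inv_def less_Suc_eq by blast

text \<open>At a vertex of the triple of \<open>i\<close> there is no chosen edge of part
  \<open>p\<close> (\<open>fresh\<close>), and two chosen edges there would both belong to the other
  part, contradicting the matching condition. So all three vertices have degree at most one in
  \<open>L\<close>, as \<open>mated_paths_insert\<close> requires.\<close>

lemma select_inv_step:
  assumes two: "\<forall>k<m. part k \<in> {1, 2}" "p \<in> {1, 2}" and "p \<notin> S"
    and S: "spanning p num root par pe tr"
    and pf: "pseudoforest (f ` {..<n}) (edge ` label_class p)"
    and inv: "select_inv p S num pe tr i out mate" and i: "i \<in> nontree p tr"
  defines "u \<equiv> top_end num i" and "w \<equiv> bot_end num i"
  defines "y \<equiv> if mate u = w then par u else w" and "e \<equiv> if mate u = w then pe u else i"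
  shows "select_inv p S num pe tr (Suc i) (out(e := 3)) (mate(mate u := mate y, mate y := mate u))"
proof -
  note top = nontree_top[OF S i, folded u_def w_def]
  note par = nontree_parent[OF S i, folded u_def w_def]
  have valid: "\<forall>k<m. out k = part k \<or> out k = 3" "mated_paths {..<n} (ends ` chosen out) mate"
    and matching: "\<And>k l. k \<in> chosen out \<Longrightarrow> l \<in> chosen out \<Longrightarrow> k \<noteq> l \<Longrightarrow> part k = part l \<Longrightarrow>
      ends k \<inter> ends l = {}"
    and hit: "\<forall>q\<in>S. hits out q"
    and src_: "\<And>k. k \<in> chosen out \<Longrightarrow> part k \<in> S \<or>
       part k = p \<and> (\<exists>j<i. j \<in> nontree p tr \<and> ends k \<subseteq> triple num pe j)"
    and done_: "\<And>j. j < i \<Longrightarrow> j \<in> nontree p tr \<Longrightarrow> out j = 3 \<or> out (pe (top_end num j)) = 3"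
    using inv unfolding select_inv_def valid_choice_def by (simp_all del: fun_upd_apply)
  have e: "e \<in> label_class p" "ends e = {u, y}" "e = i \<or> e = pe u"
    using i par(2,3) ends_top_bot[of i num]
    by (auto simp: e_def y_def u_def w_def nontree_def tree_edges_def)
  then have em: "e < m" "part e = p" by (auto simp: label_class_def)
  have trip: "triple num pe i = {u, w, par u}"
    using par(3) ends_top_bot[of i num] by (auto simp: triple_def u_def w_def)
  then have e_trip: "ends e \<subseteq> triple num pe i" using e(2) by (auto simp: y_def)
  have fresh: "ends k \<inter> triple num pe i = {}" if "k \<in> chosen out" "part k = p" for k
  proof -
    \<comment> \<open>As \<open>p\<close> is not yet processed, the edge was chosen in the current
      loop and comes from an earlier triple.\<close>
    from src_[OF that(1)] that(2) \<open>p \<notin> S\<close> obtain j where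
      "j < i" "j \<in> nontree p tr" "ends k \<subseteq> triple num pe j" by auto
    with triple_disjoint[OF S pf _ i] show ?thesis by blast
  qed
  have fin: "finite (ends ` chosen out)" by (simp add: chosen_def)
  have deg: "card {d \<in> ends ` chosen out. x \<in> d} \<le> 1" if "x \<in> triple num pe i" for x
  proof -
    have "k = l" if "k \<in> chosen out" "x \<in> ends k" "l \<in> chosen out" "x \<in> ends l" for k l
    proof -
      have "part k \<noteq> p" "part l \<noteq> p" using fresh that \<open>x \<in> triple num pe i\<close> by blast+
      moreover have "part k \<in> {1, 2}" "part l \<in> {1, 2}" using two(1) that by (auto simp: chosen_def)
      ultimately have "part k = part l" using two(2) by auto
      then show "k = l" using matching that by blast
    qed
    then have "\<forall>d\<in>{d \<in> ends ` chosen out. x \<in> d}. \<forall>d'\<in>{d \<in> ends ` chosen out. x \<in> d}. d = d'"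
      by blast
    then show ?thesis using fin by (simp add: card_le_Suc0_iff_eq)
  qed
  have uwz: "u \<noteq> w" "u \<noteq> par u" "w \<noteq> par u" using top(4) par(4,5) by auto
  have "mated_paths {..<n} (insert {u, y} (ends ` chosen out))
      (mate(mate u := mate y, mate y := mate u))"
    unfolding y_def
    by (rule mated_paths_insert[OF valid(2) fin _ uwz]) (use deg trip top(1,2) par(1) in auto)
  then have paths: "mated_paths {..<n} (ends ` chosen (out(e := 3)))
      (mate(mate u := mate y, mate y := mate u))"
    using em e(2) by (simp add: chosen_upd)
  have new: "ends k \<inter> ends e = {}" if "k \<in> chosen out" "part k = part e" for k
    using fresh[OF that(1)] that(2) em(2) e_trip by blast
  have "ends k \<inter> ends l = {}"
    if "k \<in> insert e (chosen out)" "l \<in> insert e (chosen out)" "k \<noteq> l" "part k = part l" for k l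
    using that matching new by (metis Int_commute insertE)
  then have "valid_choice (out(e := 3)) (mate(mate u := mate y, mate y := mate u))"
    using paths valid(1) em(1) unfolding valid_choice_def by (simp add: chosen_upd)
  moreover have "\<forall>q\<in>S. hits (out(e := 3)) q" using hit hits_upd em(1) by blast
  moreover have "part k \<in> S \<or>
      part k = p \<and> (\<exists>j<Suc i. j \<in> nontree p tr \<and> ends k \<subseteq> triple num pe j)"
    if "k \<in> chosen (out(e := 3))" for k
  proof (cases "k = e")
    case True
    with em e_trip i show ?thesis by blast
  next
    case False
    with that em have "k \<in> chosen out" by (simp add: chosen_upd)
    with src_ show ?thesis using less_SucI by blast
  qed
  moreover have "(out(e := 3)) j = 3 \<or> (out(e := 3)) (pe (top_end num j)) = 3"
    if "j < Suc i" "j \<in> nontree p tr" for j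
    using that done_[of j] e(3) by (auto simp: less_Suc_eq u_def)
  ultimately show ?thesis unfolding select_inv_def by blast
qed

text \<open>By \<open>nontree_hits\<close>, every cycle of the part contains both candidates of some
  \<open>k\<close>, and one of these has been taken.\<close>

lemma select_inv_final:
  assumes S: "spanning p num root par pe tr"
    and pf: "pseudoforest (f ` {..<n}) (edge ` label_class p)"
    and inv: "select_inv p S num pe tr m out mate"
  shows "partial_choice (insert p S) out mate"
proof -
  have "hits out p"
    unfolding hits_def
  proof
    fix C assume "C \<in> cycles (edge ` label_class p)"
    from nontree_hits[OF S pf this] obtain k where
      k: "k \<in> nontree p tr" "edge k \<in> C" "edge (pe (top_end num k)) \<in> C" by blast
    then have "k < m" "pe (top_end num k) < m"
      using nontree_parent(2)[OF S k(1)] by (auto simp: nontree_def tree_edges_def label_class_def)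
    moreover from this k(1) have "out k = 3 \<or> out (pe (top_end num k)) = 3"
      using inv by (simp add: select_inv_def)
    ultimately show "\<exists>k\<in>chosen out. edge k \<in> C" using k by (auto simp: chosen_def)
  qed
  with inv show ?thesis by (auto simp: partial_choice_def select_inv_def)
qed

lemma wp_phase:
  assumes two: "\<forall>k<m. part k \<in> {1, 2}" "p \<in> {1, 2}" and "p \<notin> S"
    and pf: "pseudoforest (f ` {..<n}) (edge ` label_class p)"
    and F: "frame out mate s" and J: "partial_choice S out mate"
  shows "wp (phase p) (\<lambda>t s'. t \<le> 70 * (n + m) + 30 \<and>
    (\<exists>out' mate'. frame out' mate' s' \<and> partial_choice (insert p S) out' mate')) s"
  unfolding phase_def Seqs.simps wp_Seq wp_Store
proof (rule wp_mono[OF wp_spanning_forest[OF F]], elim conjE)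
  fix t s
  assume t: "t \<le> 54 * (n + m) + 20" and F: "frame out mate s"
    and S: "spanning p (s ''num'') (s ''root'') (s ''par'') (s ''pe'') (s ''tr'')"
  define I where "I i s' \<longleftrightarrow> (\<exists>out mate. frame out mate s' \<and> s' ''num'' = s ''num'' \<and>
    s' ''par'' = s ''par'' \<and> s' ''pe'' = s ''pe'' \<and> s' ''tr'' = s ''tr'' \<and>
    select_inv p S (s ''num'') (s ''pe'') (s ''tr'') i out mate)" for i s'
  let ?s = "s(''i'' := (s ''i'')(aval (Const 0) s := aval (Const 0) s))"
  \<comment> \<open>The longest run of \<open>select_body\<close> takes 14 steps. With the test this
    gives 15 per edge, and 54 + 15 is below 70.\<close>
  have "wp (While (Less (Var ''i'') (Var ''m'')) (select_body p)) (\<lambda>t s'. t \<le> (14 + 1) * m + 1 \<and> I m s') ?s"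
  proof (rule wp_count)
    fix i s' assume i: "i < m" "s' ''i'' 0 = i" "I i s'"
    then obtain out mate where F: "frame out mate s'" and eq: "s' ''num'' = s ''num''"
      "s' ''par'' = s ''par''" "s' ''pe'' = s ''pe''" "s' ''tr'' = s ''tr''"
      and inv: "select_inv p S (s ''num'') (s ''pe'') (s ''tr'') i out mate"
      by (auto simp: I_def)
    show "wp (select_body p) (\<lambda>t s'. t \<le> 14 \<and> s' ''i'' 0 = Suc i \<and> I (Suc i) s') s'"
    proof (cases "i \<in> nontree p (s ''tr'')")
      case False
      with i(1) have "part i = p \<Longrightarrow> s ''tr'' i \<noteq> 0" by (auto simp: nontree_def label_class_def)
      with F eq i(2) select_inv_skip[OF inv False] show ?thesis
        by (auto simp: select_body_def I_def frame_def)
    next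
      case True
      then have "part i = p" "s ''tr'' i = 0" by (auto simp: nontree_def label_class_def)
      with F eq i(2) select_inv_step[OF two \<open>p \<notin> S\<close> S pf inv True] show ?thesis
        by (auto simp: select_body_def I_def frame_def top_end_def bot_end_def split: if_splits)
    qed
  next
    show "I 0 ?s"
      using F J by (auto simp: I_def frame_def select_inv_def partial_choice_def)
  qed (auto simp: I_def frame_def)
  moreover have "\<exists>out' mate'. frame out' mate' s' \<and> partial_choice (insert p S) out' mate'"
    if "I m s'" for s'
    using that select_inv_final[OF S pf] unfolding I_def by blast
  ultimately show "wp (While (Less (Var ''i'') (Var ''m'')) (select_body p)) (\<lambda>t'' s'.
     t + (1 + t'') \<le> 70 * (n + m) + 30 \<and>
     (\<exists>out' mate'. frame out' mate' s' \<and> partial_choice (insert p S) out' mate')) ?s"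
    by (elim wp_mono) (use t in auto)
qed

end

section \<open>The whole program and its output\<close>

definition partition_program :: com where
  "partition_program = Seqs [
     Assign ''i'' (Const 0),
     While (Less (Var ''i'') (Var ''m''))
       (Seq (Store ''out'' (Var ''i'') (Get ''part'' (Var ''i''))) (Inc_Var ''i'')),
     Assign ''i'' (Const 0),
     While (Less (Var ''i'') (Var ''n''))
       (Seq (Store ''mate'' (Var ''i'') (Var ''i'')) (Inc_Var ''i'')),
     phase 1,
     phase 2]"

context labelled_graph
begin

lemma partial_choice_init:
  assumes "\<forall>k<m. part k \<in> {1, 2}" "\<forall>k<m. out k = part k" "\<forall>v<n. mate v = v"
  shows "partial_choice {} out mate"
proof -
  have none: "chosen out = {}" using assms(1,2) by (auto simp: chosen_def)
  have "mated_paths {..<n} {} mate"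
    unfolding mated_paths_def
  proof
    fix v assume "v \<in> {..<n}"
    with assms(3) show "\<exists>xs. v \<in> set xs \<and> set xs \<subseteq> {..<n} \<and> component_path {} xs \<and>
        mate (hd xs) = last xs \<and> mate (last xs) = hd xs"
      by (intro exI[of _ "[v]"]) (simp add: component_path_def)
  qed
  with none assms(2) show ?thesis by (simp add: partial_choice_def valid_choice_def)
qed

lemma wp_init_out:
  assumes "frame out mate s" "s ''i'' 0 = 0"
  shows "wp (While (Less (Var ''i'') (Var ''m''))
       (Seq (Store ''out'' (Var ''i'') (Get ''part'' (Var ''i''))) (Inc_Var ''i'')))
    (\<lambda>t s'. t \<le> 3 * m + 1 \<and> (\<exists>out'. frame out' mate s' \<and> (\<forall>k<m. out' k = part k))) s"
    (is "wp (While ?b ?c) _ s")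
proof -
  define I where "I i s \<longleftrightarrow> (\<exists>out'. frame out' mate s \<and> (\<forall>k<i. out' k = part k))" for i s
  have "wp (While ?b ?c) (\<lambda>t s'. t \<le> (2 + 1) * m + 1 \<and> I m s') s"
  proof (rule wp_count)
    fix i s assume "i < m" "s ''i'' 0 = i" "I i s"
    then show "wp ?c (\<lambda>t s'. t \<le> 2 \<and> s' ''i'' 0 = Suc i \<and> I (Suc i) s') s"
      by (auto simp: I_def frame_def less_Suc_eq)
  qed (use assms in \<open>auto simp: I_def frame_def\<close>)
  then show ?thesis by (simp add: I_def)
qed

lemma wp_init_mate:
  assumes "frame out mate s" "s ''i'' 0 = 0"
  shows "wp (While (Less (Var ''i'') (Var ''n''))
       (Seq (Store ''mate'' (Var ''i'') (Var ''i'')) (Inc_Var ''i'')))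
    (\<lambda>t s'. t \<le> 3 * n + 1 \<and> (\<exists>mate'. frame out mate' s' \<and> (\<forall>v<n. mate' v = v))) s"
    (is "wp (While ?b ?c) _ s")
proof -
  define I where "I i s \<longleftrightarrow> (\<exists>mate'. frame out mate' s \<and> (\<forall>v<i. mate' v = v))" for i s
  have "wp (While ?b ?c) (\<lambda>t s'. t \<le> (2 + 1) * n + 1 \<and> I n s') s"
  proof (rule wp_count)
    fix i s assume "i < n" "s ''i'' 0 = i" "I i s"
    then show "wp ?c (\<lambda>t s'. t \<le> 2 \<and> s' ''i'' 0 = Suc i \<and> I (Suc i) s') s"
      by (auto simp: I_def frame_def less_Suc_eq)
  qed (use assms in \<open>auto simp: I_def frame_def\<close>)
  then show ?thesis by (simp add: I_def)
qed

text \<open>The two initial loops cost 3 per edge and 3 per vertex, the two phases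
  \<open>2 * 70\<close>; the rest of 150 absorbs the additive constants.\<close>

lemma wp_partition_program:
  assumes two: "\<forall>k<m. part k \<in> {1, 2}"
    and pf: "\<forall>p\<in>{1, 2}. pseudoforest (f ` {..<n}) (edge ` label_class p)"
    and F: "frame out mate s"
  shows "wp partition_program (\<lambda>t s'. t \<le> 150 * (n + m + 1) \<and>
    (\<exists>out mate. frame out mate s' \<and> partial_choice {1, 2} out mate)) s"
  unfolding partition_program_def Seqs.simps wp_Seq wp_Store
proof (rule wp_mono[OF wp_init_out[of out mate]], goal_cases)
  case (3 t s)
  then obtain out where out: "frame out mate s" "\<forall>k<m. out k = part k" "t \<le> 3 * m + 1" by blast
  show ?case
  proof (rule wp_mono[OF wp_init_mate[of out mate]], goal_cases)
    case (3 t' s')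
    then obtain mate where mate: "frame out mate s'" "\<forall>v<n. mate v = v" "t' \<le> 3 * n + 1" by blast
    have J: "partial_choice {} out mate" by (rule partial_choice_init[OF two out(2) mate(2)])
    show ?case
    proof (rule wp_mono[OF wp_phase[OF two _ _ _ mate(1) J]], goal_cases)
      case (4 u s'')
      then obtain out mate where 1: "u \<le> 70 * (n + m) + 30" "frame out mate s''"
        "partial_choice {1} out mate" by blast
      show ?case
      proof (rule wp_mono[OF wp_phase[OF two _ _ _ 1(2,3)]], goal_cases)
        case (4 u' s''')
        moreover have "{2, 1} = {1, 2 :: nat}" by auto
        ultimately show ?case using out(3) mate(3) 1(1) by auto
      qed (use pf in auto)
    qed (use pf in auto)
  qed (use out in \<open>auto simp: frame_def\<close>)
qed (use F in \<open>auto simp: frame_def\<close>)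

text \<open>A cycle among the remaining edges would be a cycle of the original part and so contain
  an edge labelled 3.\<close>

lemma partial_choice_forest:
  assumes J: "partial_choice S out mate" and "p \<in> S" "p \<noteq> 3"
  shows "forest (edge ` {k. k < m \<and> out k = p})"
proof (rule ccontr)
  let ?F = "edge ` {k. k < m \<and> out k = p}"
  assume "\<not> forest ?F"
  then obtain C where C: "C \<in> cycles ?F" by (auto simp: forest_def)
  then have sub: "C \<subseteq> ?F" by (auto simp: cycles_def)
  have "{k. k < m \<and> out k = p} \<subseteq> label_class p"
    using J assms(3) by (force simp: partial_choice_def valid_choice_def label_class_def)
  then have "?F \<subseteq> edge ` label_class p" by blast
  with C have "C \<in> cycles (edge ` label_class p)" using cycles_mono by (meson subsetD)
  moreover have "hits out p" using J assms(2) by (simp add: partial_choice_def)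
  ultimately obtain k where k: "k \<in> chosen out" "edge k \<in> C" unfolding hits_def by blast
  with sub obtain l where "l < m" "out l = p" "edge k = edge l" by auto
  with k assms(3) edge_inj show False by (auto simp: chosen_def)
qed

lemma partial_choice_linear_forest:
  assumes J: "partial_choice S out mate"
  shows "linear_forest (f ` {..<n}) (edge ` chosen out)"
proof (rule linear_forestI)
  have E: "edge ` chosen out = (`) f ` ends ` chosen out" by (auto simp: edge_def)
  have sub: "\<Union>(ends ` chosen out) \<subseteq> {..<n}" using ends_subset by (fastforce simp: chosen_def)
  fix x assume "x \<in> f ` {..<n}"
  then obtain v where v: "v \<in> {..<n}" "x = f v" by blast
  moreover have "mated_paths {..<n} (ends ` chosen out) mate"
    using J by (simp add: partial_choice_def valid_choice_def)
  ultimately obtain xs where xs: "v \<in> set xs" "set xs \<subseteq> {..<n}" "component_path (ends ` chosen out) xs"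
    unfolding mated_paths_def by blast
  have "component_path (edge ` chosen out) (map f xs)"
    unfolding E by (rule component_path_map[OF xs(3) inj_f xs(2) sub])
  with xs(1) v(2) show "\<exists>xs. x \<in> set xs \<and> component_path (edge ` chosen out) xs"
    by (intro exI[of _ "map f xs"]) simp
next
  show "\<Union>(edge ` chosen out) \<subseteq> f ` {..<n}" using edge_subset by (fastforce simp: chosen_def)
  show "{} \<notin> edge ` chosen out" using edge_nonempty by (metis imageE)
qed

text \<open>Consecutive edges of a path are distinct and share a vertex, so by the matching
  condition they come from different parts, and there are only two.\<close>

lemma partial_choice_alternating:
  assumes J: "partial_choice {1, 2} out mate"
  shows "alternating_forest V (edge ` label_class 1) (edge ` label_class 2) (edge ` chosen out)"
  unfolding alternating_forest_def
proof (intro ballI allI impI)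
  fix K xs assume "is_path_of (edge ` chosen out) K xs"
  then have xs: "distinct xs" "path_edges xs \<subseteq> edge ` chosen out"
    by (auto simp: is_path_of_def)
  have part: "part k = 1 \<or> part k = 2" if "k \<in> chosen out" for k
    using J that by (auto simp: partial_choice_def)
  have lc: "k \<in> label_class (part k)" if "k \<in> chosen out" for k
    using that by (simp add: chosen_def label_class_def)
  show "alternating_path (edge ` label_class 1) (edge ` label_class 2) xs"
    unfolding alternating_path_def
  proof (intro conjI allI impI)
    have "edge ` chosen out \<subseteq> edge ` label_class 1 \<union> edge ` label_class 2"
      using part lc by fastforce
    with xs(2) show "path_edges xs \<subseteq> edge ` label_class 1 \<union> edge ` label_class 2" by blast
  next
    fix i assume i: "Suc (Suc i) < length xs"
    let ?d = "{xs ! i, xs ! Suc i}" and ?e = "{xs ! Suc i, xs ! Suc (Suc i)}"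
    have "?d \<in> path_edges xs" "?e \<in> path_edges xs" using i by (auto simp: path_edges_def)
    with xs(2) obtain k l where k: "k \<in> chosen out" "?d = edge k" and l: "l \<in> chosen out" "?e = edge l"
      by blast
    have "?d \<noteq> ?e" using xs(1) i by (auto simp: doubleton_eq_iff nth_eq_iff_index_eq)
    then have "k \<noteq> l" using k l by auto
    have "xs ! Suc i \<in> f ` ends k" "xs ! Suc i \<in> f ` ends l"
      using k(2) l(2) by (auto simp: edge_def)
    then obtain a b where ab: "a \<in> ends k" "b \<in> ends l" "f a = f b" by force
    moreover have "a \<in> {..<n}" "b \<in> {..<n}"
      using ab(1,2) k(1) l(1) ends_subset by (auto simp: chosen_def)
    ultimately have "ends k \<inter> ends l \<noteq> {}" using inj_f by (auto dest: inj_onD)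
    then have "part k \<noteq> part l"
      using J k(1) l(1) \<open>k \<noteq> l\<close> unfolding partial_choice_def valid_choice_def by blast
    then have "part k = 1 \<and> part l = 2 \<or> part k = 2 \<and> part l = 1"
      using part k(1) l(1) by metis
    then show "?d \<in> edge ` label_class 1 \<and> ?e \<in> edge ` label_class 2 \<or>
        ?d \<in> edge ` label_class 2 \<and> ?e \<in> edge ` label_class 1"
      using lc[OF k(1)] lc[OF l(1)] k(2) l(2) by auto
  qed
qed

end

theorem theorem6:
  "\<exists>(prog :: com) (K :: nat). \<forall>(V :: 'a set) E P\<^sub>1 P\<^sub>2 vs es.
     simple_graph V E \<and>
     P\<^sub>1 \<union> P\<^sub>2 = E \<and> P\<^sub>1 \<inter> P\<^sub>2 = {} \<and>
     pseudoforest V P\<^sub>1 \<and> pseudoforest V P\<^sub>2 \<and>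
     graph_input V E vs es \<longrightarrow>
     (\<exists>t s F\<^sub>1 F\<^sub>2 L.
        exec prog (input_memory vs es P\<^sub>1) t s \<and>
        t \<le> K * (card V + card E + 1) \<and>
        F\<^sub>1 = output_class vs es s 1 \<and>
        F\<^sub>2 = output_class vs es s 2 \<and>
        L = output_class vs es s 3 \<and>
        F\<^sub>1 \<union> F\<^sub>2 \<union> L = E \<and>
        F\<^sub>1 \<inter> F\<^sub>2 = {} \<and> F\<^sub>1 \<inter> L = {} \<and> F\<^sub>2 \<inter> L = {} \<and>
        forest F\<^sub>1 \<and> forest F\<^sub>2 \<and>
        linear_forest V L \<and>
        alternating_forest V P\<^sub>1 P\<^sub>2 L)"
proof (rule exI[of _ partition_program], rule exI[of _ 150], intro allI impI, elim conjE)
  fix V :: "'a set" and E P\<^sub>1 P\<^sub>2 vs es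
  assume G: "simple_graph V E" and P: "P\<^sub>1 \<union> P\<^sub>2 = E" "P\<^sub>1 \<inter> P\<^sub>2 = {}"
    and pf: "pseudoforest V P\<^sub>1" "pseudoforest V P\<^sub>2" and input: "graph_input V E vs es"
  let ?s = "input_memory vs es P\<^sub>1"
  let ?n = "length vs" and ?m = "length es" and ?src = "?s ''src''" and ?tgt = "?s ''tgt''"
    and ?part = "?s ''part''" and ?f = "(!) vs"
  have src: "?src k = fst (es ! k)" "?tgt k = snd (es ! k)"
    "?part k = (if edge_at vs es k \<in> P\<^sub>1 then 1 else 2)" if "k < ?m" for k
    using that by (simp_all add: input_memory_def)
  have vs: "distinct vs" "set vs = V" and bij: "bij_betw (edge_at vs es) {..<?m} E"
    and less: "\<And>k. k < ?m \<Longrightarrow> fst (es ! k) < ?n \<and> snd (es ! k) < ?n"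
    using input by (auto simp: graph_input_def case_prod_unfold)
  have edge_at: "edge_at vs es k = ?f ` {?src k, ?tgt k}" if "k < ?m" for k
    using src[OF that] by (simp add: edge_at_def)
  \<comment> \<open>Loops are excluded by \<open>simple_graph\<close>, parallel edges by the
    injectivity of \<open>edge_at\<close>: every edge is listed once.\<close>
  interpret labelled_graph ?n ?m ?src ?tgt ?part ?f
  proof
    fix k assume k: "k < ?m"
    show "?src k < ?n" "?tgt k < ?n" using less[OF k] src[OF k] by simp_all
    have "edge_at vs es k \<in> E" using bij k by (auto simp: bij_betw_def)
    then obtain u v where "u \<noteq> v" "edge_at vs es k = {u, v}" using G unfolding simple_graph_def by blast
    with edge_at[OF k] show "?src k \<noteq> ?tgt k" by auto
    fix l assume l: "l < ?m" "{?src k, ?tgt k} = {?src l, ?tgt l}"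
    then have "edge_at vs es k = edge_at vs es l" using k by (simp only: edge_at)
    with bij k l(1) show "k = l" by (auto simp: bij_betw_def dest: inj_onD)
  next
    show "inj_on ?f {..<?n}" using vs(1) by (simp add: inj_on_nth)
  qed
  have edge: "edge k = edge_at vs es k" if "k < ?m" for k
    using edge_at[OF that] by (simp add: edge_def ends_def)
  have V: "?f ` {..<?n} = V" using vs(2) by (auto simp: in_set_conv_nth)
  have E: "edge ` {..<?m} = E" using bij edge by (auto simp: bij_betw_def)
  have class1: "edge ` label_class 1 = P\<^sub>1"
  proof -
    have eq: "label_class 1 = {k. k < ?m \<and> edge k \<in> P\<^sub>1}" using src(3) edge by (auto simp: label_class_def split: if_splits)
    have "P\<^sub>1 \<subseteq> edge ` {..<?m}" unfolding E using P(1) by auto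
    then show ?thesis unfolding eq by blast
  qed
  \<comment> \<open>Label 2 marks the edges outside the first part; since the parts are disjoint and
    cover \<open>E\<close>, these are exactly the edges of the second.\<close>
  have class2: "edge ` label_class 2 = P\<^sub>2"
  proof -
    have eq: "label_class 2 = {k. k < ?m \<and> edge k \<notin> P\<^sub>1}" using src(3) edge by (auto simp: label_class_def split: if_splits)
    have "P\<^sub>2 = {e \<in> edge ` {..<?m}. e \<notin> P\<^sub>1}" unfolding E using P by auto
    then show ?thesis unfolding eq by auto
  qed
  have "frame (?s ''out'') (?s ''mate'') ?s" unfolding frame_def by (simp add: input_memory_def)
  then have "wp partition_program (\<lambda>t s'. t \<le> 150 * (?n + ?m + 1) \<and>
    (\<exists>out mate. frame out mate s' \<and> partial_choice {1, 2} out mate)) ?s"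
    using src(3) pf class1 class2 V by (intro wp_partition_program) auto
  then obtain t s out mate where exec: "exec partition_program ?s t s" "t \<le> 150 * (?n + ?m + 1)"
    and F: "frame out mate s" and J: "partial_choice {1, 2} out mate"
    unfolding wp_def by blast
  have card: "card V = ?n" "card E = ?m"
    using vs bij by (auto simp: distinct_card bij_betw_same_card[symmetric])
  have out_class: "output_class vs es s l = edge ` {k. k < ?m \<and> out k = l}" for l
    using F edge by (auto simp: output_class_def frame_def)
  have L: "output_class vs es s 3 = edge ` chosen out" by (simp add: out_class chosen_def)
  have "out k = 1 \<or> out k = 2 \<or> out k = 3" if "k < ?m" for k
  proof -
    have "out k = ?part k \<or> out k = 3"
      using J that by (simp add: partial_choice_def valid_choice_def)
    then show ?thesis using src(3)[OF that] by (simp split: if_splits) blast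
  qed
  then have "{..<?m} = {k. k < ?m \<and> out k = 1} \<union> {k. k < ?m \<and> out k = 2} \<union> {k. k < ?m \<and> out k = 3}"
    by auto
  then have "output_class vs es s 1 \<union> output_class vs es s 2 \<union> output_class vs es s 3 = E"
    unfolding out_class E[symmetric] by (metis image_Un)
  moreover have "output_class vs es s k \<inter> output_class vs es s l = {}" if "k \<noteq> l" for k l
    using that edge_inj by (auto simp: out_class)
  moreover have "forest (output_class vs es s 1)" "forest (output_class vs es s 2)"
    unfolding out_class by (rule partial_choice_forest[OF J]; simp)+
  moreover have "linear_forest V (output_class vs es s 3)"
    using partial_choice_linear_forest[OF J] unfolding L V .
  moreover have "alternating_forest V P\<^sub>1 P\<^sub>2 (output_class vs es s 3)"
    using partial_choice_alternating[OF J] unfolding L class1 class2 .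
  ultimately show "\<exists>t s F\<^sub>1 F\<^sub>2 L.
        exec partition_program ?s t s \<and>
        t \<le> 150 * (card V + card E + 1) \<and>
        F\<^sub>1 = output_class vs es s 1 \<and>
        F\<^sub>2 = output_class vs es s 2 \<and>
        L = output_class vs es s 3 \<and>
        F\<^sub>1 \<union> F\<^sub>2 \<union> L = E \<and>
        F\<^sub>1 \<inter> F\<^sub>2 = {} \<and> F\<^sub>1 \<inter> L = {} \<and> F\<^sub>2 \<inter> L = {} \<and>
        forest F\<^sub>1 \<and> forest F\<^sub>2 \<and>
        linear_forest V L \<and>
        alternating_forest V P\<^sub>1 P\<^sub>2 L"
    using exec card by (intro exI[of _ t] exI[of _ s]) simp
qed

end
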